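(* For any $z_0\in[\underline z_1^*,\bar z_1^*]$ such that $\psi_1(z_0)=1$ and for any $k\in\mathbb{Z}_+$, the vectors $\boldsymbol u^{C_1}(z_0)$ and $\boldsymbol u^{C_1}(z_0)A^{(1)}_{*,1}(z_0)N_1(z_0)R_1(z_0)^k$ are (entry-wise) positive. Analogously, for any $w_0\in[\underline z_2^*,\bar z_2^*]$ such that $\psi_2(w_0)=1$ and for any $k\in\mathbb{Z}_+$, the vectors $\boldsymbol u^{C_2}(w_0)$ and $\boldsymbol u^{C_2}(w_0)A^{(2)}_{1,*}(w_0)N_2(w_0)R_2(w_0)^k$ are positive.
   Context: Let $\mathbb{H}=\{-1,0,1\}$, $\mathbb{H}_+=\{0,1\}$, and let $S_0=\{1,\dots,s_0\}$ be finite. Let $A_{i,j}$ ($i,j\in\mathbb{H}$), $A^{(1)}_{i,j}$ ($i\in\mathbb{H},j\in\mathbb{H}_+$), $A^{(2)}_{i,j}$ ($i\in\mathbb{H}_+,j\in\mathbb{H}$) be nonnegative $s_0\times s_0$ matrices such that $\sum A_{i,j}$, $\sum A^{(1)}_{i,j}$, $\sum A^{(2)}_{i,j}$ are stochastic. Standing assumption: the following three Markov chains are irreducible and aperiodic: the chain on $\mathbb{Z}^2\times S_0$ with transition block $A_{i,j}$ from $(x_1,x_2)$ to $(x_1+i,x_2+j)$; the chain on $\mathbb{Z}\times\mathbb{Z}_+\times S_0$ with block $A_{i,j}$ if $x_2\ne0$ and $A^{(1)}_{i,j}$ if $x_2=0$; the chain on $\mathbb{Z}_+\times\mathbb{Z}\times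 S_0$ with block $A_{i,j}$ if $x_1\neq0$ and $A^{(2)}_{i,j}$ if $x_1=0$. $\mathrm{spr}$ denotes spectral radius. $A_{*,j}(z)=\sum_{i\in\mathbb{H}}A_{i,j}z^i$, $A_{i,*}(w)=\sum_{j\in\mathbb{H}}A_{i,j}w^j$, $A^{(1)}_{*,i}(z)=\sum_{j\in\mathbb{H}}A^{(1)}_{j,i}z^j$, $A^{(2)}_{i,*}(w)=\sum_{j\in\mathbb{H}}A^{(2)}_{i,j}w^j$. $\log\underline z_i^*$ and $\log\bar z_i^*$ are the minimum and maximum of $s_i$ over the compact set $\{(s_1,s_2)\in\mathbb{R}^2:\mathrm{spr}(\sum_{i,j}A_{i,j}e^{is_1+js_2})\le1\}$. For $z\in[\underline z_1^*,\bar z_1^*]$, $N_1(z)=I+\sum_{n\ge1}\sum A_{*,i_1}(z)\cdots A_{*,i_n}(z)$, the inner sum being over $(i_1,\dots,i_n)\in\mathbb{H}^n$ with $\sum_{l\le k}i_l\ge0$ for $1\le k\le n-1$ and $\sum_{l\le n}i_l=0$ (a convergent series); $G_1(z)=N_1(z)A_{*,-1}(z)$ and $R_1(z)=A_{*,1}(z)N_1(z)$, which are the minimal nonnegative solutions of $A_{*,-1}(z)+A_{*,0}(z)X+A_{*,1}(z)X^2=X$ and $X^2A_{*,-1}(z)+XA_{*,0}(z)+A_{*,1}(z)=X$. For $w\in[\underline z_2^*,\bar z_2^*]$, $N_2(w),G_2(w),R_2(w)$ are defined in the same way with $A_{i,*}(w)$ in place of $A_{*,i}(z)$, $i\in\mathbb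 H$. $C_1(z,X)=A^{(1)}_{*,0}(z)+A^{(1)}_{*,1}(z)X$, $C_2(X,w)=A^{(2)}_{0,*}(w)+A^{(2)}_{1,*}(w)X$, $\psi_1(z)=\mathrm{spr}(C_1(z,G_1(z)))$, $\psi_2(w)=\mathrm{spr}(C_2(G_2(w),w))$. $\boldsymbol u^{C_1}(z),\boldsymbol v^{C_1}(z)$ are the Perron–Frobenius left and right eigenvectors of $C_1(z,G_1(z))$ for the eigenvalue $\psi_1(z)$, normalized by $\boldsymbol u^{C_1}(z)\boldsymbol v^{C_1}(z)=1$; $\boldsymbol u^{C_2}(w),\boldsymbol v^{C_2}(w)$ are the analogous eigenvectors of $C_2(G_2(w),w)$ for $\psi_2(w)$. *)

theory Defs
  imports "HOL-Analysis.Analysis"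
begin

text \<open>
  The finite set of phases \<open>S\<^sub>0\<close> is the finite type \<open>'s\<close>.  The block families are functions
  on \<open>int \<times> int\<close>; only their values at the admissible indices enter any definition.
\<close>

type_synonym 's block = "real ^ 's ^ 's"

definition HH :: "int set" where "HH = {-1, 0, 1}"

definition HHp :: "int set" where "HHp = {0, 1}"


section \<open>Matrices\<close>

definition nonneg_mat :: "'s::finite block \<Rightarrow> bool" where
  "nonneg_mat M \<longleftrightarrow> (\<forall>a b. 0 \<le> M $ a $ b)"

definition stochastic :: "'s::finite block \<Rightarrow> bool" where
  "stochastic M \<longleftrightarrow> nonneg_mat M \<and> (\<forall>a. (\<Sum>b\<in>UNIV. M $ a $ b) = 1)"

definition pos_vec :: "real ^ 's::finite \<Rightarrow> bool" where
  "pos_vec x \<longleftrightarrow> (\<forall>a. 0 < x $ a)"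

definition nonneg_vec :: "real ^ 's::finite \<Rightarrow> bool" where
  "nonneg_vec x \<longleftrightarrow> (\<forall>a. 0 \<le> x $ a)"

primrec mat_power :: "'s::finite block \<Rightarrow> nat \<Rightarrow> 's block" where
  "mat_power M 0 = mat 1"
| "mat_power M (Suc k) = M ** mat_power M k"

definition complex_mat :: "'s::finite block \<Rightarrow> complex ^ 's ^ 's" where
  "complex_mat M = (\<chi> a b. complex_of_real (M $ a $ b))"

definition spr :: "'s::finite block \<Rightarrow> real" where
  "spr M = Max {cmod l | l. \<exists>x. x \<noteq> 0 \<and> complex_mat M *v x = l *s x}"

text \<open>
  The normalization \<open>u v = 1\<close> fixes the pair only up to \<open>(c u, v / c)\<close>, \<open>c > 0\<close>, so this is a
  predicate rather than a function of the matrix.  It also forces both vectors to be nonzero.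
\<close>

definition perron_frobenius_pair ::
  "'s::finite block \<Rightarrow> real ^ 's \<Rightarrow> real ^ 's \<Rightarrow> bool" where
  "perron_frobenius_pair M u v \<longleftrightarrow>
     nonneg_vec u \<and> nonneg_vec v \<and>
     u v* M = spr M *s u \<and> M *v v = spr M *s v \<and> u \<bullet> v = 1"


section \<open>Markov chains with a transition kernel \<open>P\<close> on a state space \<open>X\<close>\<close>

primrec nstep :: "('x \<Rightarrow> 'x \<Rightarrow> real) \<Rightarrow> 'x set \<Rightarrow> nat \<Rightarrow> 'x \<Rightarrow> 'x \<Rightarrow> real" where
  "nstep P X 0 x y = (if x = y then 1 else 0)"
| "nstep P X (Suc n) x y = (\<Sum>\<^sub>\<infinity>z\<in>X. P x z * nstep P X n z y)"

definition irreducible_chain :: "('x \<Rightarrow> 'x \<Rightarrow> real) \<Rightarrow> 'x set \<Rightarrow> bool" where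
  "irreducible_chain P X \<longleftrightarrow> (\<forall>x\<in>X. \<forall>y\<in>X. \<exists>n. 0 < nstep P X n x y)"

definition aperiodic_chain :: "('x \<Rightarrow> 'x \<Rightarrow> real) \<Rightarrow> 'x set \<Rightarrow> bool" where
  "aperiodic_chain P X \<longleftrightarrow> (\<forall>x\<in>X. Gcd {n. 1 \<le> n \<and> 0 < nstep P X n x x} = 1)"

type_synonym 's state = "int \<times> int \<times> 's"

fun plane_kernel ::
  "(int \<Rightarrow> int \<Rightarrow> 's::finite block) \<Rightarrow> 's state \<Rightarrow> 's state \<Rightarrow> real" where
  "plane_kernel A (x1, x2, a) (y1, y2, b) =
     (if y1 - x1 \<in> HH \<and> y2 - x2 \<in> HH then A (y1 - x1) (y2 - x2) $ a $ b else 0)"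

fun upper_kernel ::
  "(int \<Rightarrow> int \<Rightarrow> 's::finite block) \<Rightarrow> (int \<Rightarrow> int \<Rightarrow> 's block) \<Rightarrow> 's state \<Rightarrow> 's state \<Rightarrow> real"
where
  "upper_kernel A A1 (x1, x2, a) (y1, y2, b) =
     (if x2 \<noteq> 0 then plane_kernel A (x1, x2, a) (y1, y2, b)
      else if y1 - x1 \<in> HH \<and> y2 - x2 \<in> HHp then A1 (y1 - x1) (y2 - x2) $ a $ b else 0)"

fun right_kernel ::
  "(int \<Rightarrow> int \<Rightarrow> 's::finite block) \<Rightarrow> (int \<Rightarrow> int \<Rightarrow> 's block) \<Rightarrow> 's state \<Rightarrow> 's state \<Rightarrow> real"
where
  "right_kernel A A2 (x1, x2, a) (y1, y2, b) =
     (if x1 \<noteq> 0 then plane_kernel A (x1, x2, a) (y1, y2, b)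
      else if y1 - x1 \<in> HHp \<and> y2 - x2 \<in> HH then A2 (y1 - x1) (y2 - x2) $ a $ b else 0)"

definition upper_half :: "'s state set" where
  "upper_half = {(x1, x2, a). 0 \<le> x2}"

definition right_half :: "'s state set" where
  "right_half = {(x1, x2, a). 0 \<le> x1}"


section \<open>Matrix generating functions\<close>

text \<open>
  \<open>gf1 B j z\<close> is \<open>B\<^bsub>*,j\<^esub>(z)\<close> and \<open>gf2 B i w\<close> is \<open>B\<^bsub>i,*\<^esub>(w)\<close>; both are used with
  \<open>B\<close> one of \<open>A\<close>, \<open>A\<^sup>(\<^sup>1\<^sup>)\<close>, \<open>A\<^sup>(\<^sup>2\<^sup>)\<close>.
\<close>

definition gf1 :: "(int \<Rightarrow> int \<Rightarrow> 's::finite block) \<Rightarrow> int \<Rightarrow> real \<Rightarrow> 's block" where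
  "gf1 B j z = (\<Sum>i\<in>HH. z powi i *\<^sub>R B i j)"

definition gf2 :: "(int \<Rightarrow> int \<Rightarrow> 's::finite block) \<Rightarrow> int \<Rightarrow> real \<Rightarrow> 's block" where
  "gf2 B i w = (\<Sum>j\<in>HH. w powi j *\<^sub>R B i j)"

definition Gamma_set :: "(int \<Rightarrow> int \<Rightarrow> 's::finite block) \<Rightarrow> (real \<times> real) set" where
  "Gamma_set A =
     {(s1, s2). spr (\<Sum>i\<in>HH. \<Sum>j\<in>HH. exp (of_int i * s1 + of_int j * s2) *\<^sub>R A i j) \<le> 1}"

text \<open>
  \<open>Gamma_set A\<close> is nonempty and compact under the standing assumptions, so that the infima
  and suprema below are the minima and maxima of the coordinates.
\<close>

definition z_lower1 :: "(int \<Rightarrow> int \<Rightarrow> 's::finite block) \<Rightarrow> real" where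
  "z_lower1 A = exp (Inf (fst ` Gamma_set A))"

definition z_upper1 :: "(int \<Rightarrow> int \<Rightarrow> 's::finite block) \<Rightarrow> real" where
  "z_upper1 A = exp (Sup (fst ` Gamma_set A))"

definition z_lower2 :: "(int \<Rightarrow> int \<Rightarrow> 's::finite block) \<Rightarrow> real" where
  "z_lower2 A = exp (Inf (snd ` Gamma_set A))"

definition z_upper2 :: "(int \<Rightarrow> int \<Rightarrow> 's::finite block) \<Rightarrow> real" where
  "z_upper2 A = exp (Sup (snd ` Gamma_set A))"


section \<open>The matrices \<open>N\<close>, \<open>G\<close> and \<open>R\<close>\<close>

text \<open>
  These depend on a family \<open>a i\<close>, \<open>i \<in> HH\<close>, which is \<open>A\<^bsub>*,i\<^esub>(z)\<close> or \<open>A\<^bsub>i,*\<^esub>(w)\<close>.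
  The term \<open>n = 0\<close> of the series is the identity matrix, since \<open>walks 0 = {[]}\<close>.
\<close>

definition walks :: "nat \<Rightarrow> int list set" where
  "walks n = {is. length is = n \<and> set is \<subseteq> HH \<and>
     (\<forall>k. 1 \<le> k \<and> k < n \<longrightarrow> 0 \<le> sum_list (take k is)) \<and> sum_list is = 0}"

definition walk_weight :: "(int \<Rightarrow> 's::finite block) \<Rightarrow> int list \<Rightarrow> 's block" where
  "walk_weight a is = foldr (\<lambda>i M. a i ** M) is (mat 1)"

definition N_mat :: "(int \<Rightarrow> 's::finite block) \<Rightarrow> 's block" where
  "N_mat a = (\<Sum>n. \<Sum>is\<in>walks n. walk_weight a is)"

definition G_mat :: "(int \<Rightarrow> 's::finite block) \<Rightarrow> 's block" where
  "G_mat a = N_mat a ** a (-1)"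

definition R_mat :: "(int \<Rightarrow> 's::finite block) \<Rightarrow> 's block" where
  "R_mat a = a 1 ** N_mat a"

definition N1 :: "(int \<Rightarrow> int \<Rightarrow> 's::finite block) \<Rightarrow> real \<Rightarrow> 's block" where
  "N1 A z = N_mat (\<lambda>i. gf1 A i z)"

definition G1 :: "(int \<Rightarrow> int \<Rightarrow> 's::finite block) \<Rightarrow> real \<Rightarrow> 's block" where
  "G1 A z = G_mat (\<lambda>i. gf1 A i z)"

definition R1 :: "(int \<Rightarrow> int \<Rightarrow> 's::finite block) \<Rightarrow> real \<Rightarrow> 's block" where
  "R1 A z = R_mat (\<lambda>i. gf1 A i z)"

definition N2 :: "(int \<Rightarrow> int \<Rightarrow> 's::finite block) \<Rightarrow> real \<Rightarrow> 's block" where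
  "N2 A w = N_mat (\<lambda>i. gf2 A i w)"

definition G2 :: "(int \<Rightarrow> int \<Rightarrow> 's::finite block) \<Rightarrow> real \<Rightarrow> 's block" where
  "G2 A w = G_mat (\<lambda>i. gf2 A i w)"

definition R2 :: "(int \<Rightarrow> int \<Rightarrow> 's::finite block) \<Rightarrow> real \<Rightarrow> 's block" where
  "R2 A w = R_mat (\<lambda>i. gf2 A i w)"

definition C1 :: "(int \<Rightarrow> int \<Rightarrow> 's::finite block) \<Rightarrow> real \<Rightarrow> 's block \<Rightarrow> 's block" where
  "C1 A1 z X = gf1 A1 0 z + gf1 A1 1 z ** X"

definition C2 :: "(int \<Rightarrow> int \<Rightarrow> 's::finite block) \<Rightarrow> 's block \<Rightarrow> real \<Rightarrow> 's block" where
  "C2 A2 X w = gf2 A2 0 w + gf2 A2 1 w ** X"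

definition psi1 ::
  "(int \<Rightarrow> int \<Rightarrow> 's::finite block) \<Rightarrow> (int \<Rightarrow> int \<Rightarrow> 's block) \<Rightarrow> real \<Rightarrow> real" where
  "psi1 A A1 z = spr (C1 A1 z (G1 A z))"

definition psi2 ::
  "(int \<Rightarrow> int \<Rightarrow> 's::finite block) \<Rightarrow> (int \<Rightarrow> int \<Rightarrow> 's block) \<Rightarrow> real \<Rightarrow> real" where
  "psi2 A A2 w = spr (C2 A2 (G2 A w) w)"

end

theory Submission imports Defs begin

text \<open>
  Fix \<open>z\<close> and consider the level process, whose blocks are the generating functions in \<open>z\<close>.  If
  \<open>u\<close> is a left eigenvector of \<open>C\<^sub>1(z, G\<^sub>1(z))\<close> for the eigenvalue 1, then \<open>u\<close> and the vectors
  \<open>u A\<^sup>(\<^sup>1\<^sup>)\<^bsub>*,1\<^esub> N\<^sub>1 R\<^sub>1\<^sup>k\<close> are the components of an invariant measure of the process reflected at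
  level 0.  The support of an invariant measure is closed under transitions, hence is everything
  by irreducibility.

  This needs the series \<open>N\<^sub>1(z)\<close> to converge.  By Kingman's convexity and a compactness argument,
  every \<open>s = log z\<close> in the given interval has a \<open>t\<close> and a positive vector \<open>h\<close> such that
  \<open>e\<^sup>l\<^sup>t h\<close> is superharmonic for the level process; killing the process below level 0 then makes
  its Green function finite.
\<close>

section \<open>Spectral radius\<close>

text \<open>The eigenvalue equation is read in a coordinate where \<open>x\<close> has largest
  modulus.\<close>

lemma eigenvalue_row_sum_bound:
  fixes M :: "complex ^ 's::finite ^ 's"
  assumes "M *v x = l *s x" "x \<noteq> 0"
  shows "\<exists>a. cmod l \<le> (\<Sum>b\<in>UNIV. cmod (M $ a $ b))"
proof -
  obtain a where a: "\<And>b. cmod (x $ b) \<le> cmod (x $ a)"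
    using Max_ge[of "range (\<lambda>b. cmod (x $ b))"] Max_in[of "range (\<lambda>b. cmod (x $ b))"]
    by (smt (verit) UNIV_not_empty finite finite_imageI image_iff image_is_empty rangeI)
  have pos: "0 < cmod (x $ a)"
  proof -
    obtain c where "x $ c \<noteq> 0" using assms(2) by (auto simp: vec_eq_iff)
    then have "0 < cmod (x $ c)" by simp
    with a[of c] show ?thesis by linarith
  qed
  have "cmod l * cmod (x $ a) = cmod ((M *v x) $ a)"
    by (simp add: assms(1) norm_mult)
  also have "\<dots> \<le> (\<Sum>b\<in>UNIV. cmod (M $ a $ b * x $ b))"
    unfolding matrix_vector_mult_def by (simp add: norm_sum)
  also have "\<dots> \<le> (\<Sum>b\<in>UNIV. cmod (M $ a $ b) * cmod (x $ a))"
    by (intro sum_mono) (simp add: norm_mult a mult_left_mono)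
  also have "\<dots> = (\<Sum>b\<in>UNIV. cmod (M $ a $ b)) * cmod (x $ a)"
    by (simp add: sum_distrib_right)
  finally show ?thesis using pos by (intro exI[of _ a]) simp
qed

text \<open>\<open>spr\<close> is a \<open>Max\<close>, which is informative only over a finite set.
  Eigenvalues are roots of the characteristic polynomial \<open>det P\<close>, which is nonzero
  because the row-sum bound exhibits a number \<open>r\<close> that is not an eigenvalue.\<close>

lemma finite_eigenvalues:
  fixes M :: "complex ^ 's::finite ^ 's"
  shows "finite {l. \<exists>x. x \<noteq> 0 \<and> M *v x = l *s x}"
proof -
  define P :: "complex poly ^ 's ^ 's"
    where "P = (\<chi> a b. [:M $ a $ b:] - (if a = b then [:0, 1:] else 0))"
  define Q where "Q = (\<lambda>l. (\<chi> a b. M $ a $ b - (if a = b then l else 0)) :: complex ^ 's ^ 's)"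
  have poly_P: "poly (P $ a $ b) l = Q l $ a $ b" for a b l
    by (simp add: P_def Q_def)
  have det_Q: "poly (det P) l = det (Q l)" for l
    unfolding det_def by (simp add: poly_sum poly_prod poly_P)
  have mult_Q: "Q l *v x = M *v x - l *s x" for l x
    by (simp add: Q_def matrix_vector_mult_def vec_eq_iff left_diff_distrib sum_subtractf
        if_distrib[of "\<lambda>c. c * _"] cong: if_cong)
  have eig: "(\<exists>x. x \<noteq> 0 \<and> M *v x = l *s x) \<longleftrightarrow> poly (det P) l = 0" for l
  proof -
    have "det (Q l) \<noteq> 0 \<longleftrightarrow> (\<forall>x. Q l *v x = 0 \<longrightarrow> x = 0)"
      by (metis invertible_det_nz invertible_left_inverse matrix_left_invertible_ker)
    then show ?thesis by (auto simp: det_Q mult_Q)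
  qed
  define r where "r = (\<Sum>a\<in>UNIV. \<Sum>b\<in>UNIV. cmod (M $ a $ b)) + 1"
  have r: "0 \<le> r" unfolding r_def by (intro add_nonneg_nonneg sum_nonneg) auto
  have "\<not> (\<exists>x. x \<noteq> 0 \<and> M *v x = of_real r *s x)"
  proof
    assume "\<exists>x. x \<noteq> 0 \<and> M *v x = of_real r *s x"
    then obtain a where "cmod (of_real r) \<le> (\<Sum>b\<in>UNIV. cmod (M $ a $ b))"
      using eigenvalue_row_sum_bound by blast
    also have "\<dots> \<le> (\<Sum>a\<in>UNIV. \<Sum>b\<in>UNIV. cmod (M $ a $ b))"
      by (rule member_le_sum) (auto intro: sum_nonneg)
    finally have "r \<le> (\<Sum>a\<in>UNIV. \<Sum>b\<in>UNIV. cmod (M $ a $ b))"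
      using r by (simp only: norm_of_real abs_of_nonneg)
    then show False by (simp add: r_def)
  qed
  then have "det P \<noteq> 0" using eig by auto
  then show ?thesis unfolding eig by (rule poly_roots_finite)
qed

lemma real_eigenvalue_le_spr:
  fixes M :: "'s::finite block"
  assumes "M *v x = r *s x" "x \<noteq> 0" "0 \<le> r"
  shows "r \<le> spr M"
proof -
  let ?x = "\<chi> a. complex_of_real (x $ a)"
  have "complex_mat M *v ?x = complex_of_real r *s ?x"
    using assms(1) unfolding complex_mat_def
    by (simp add: vec_eq_iff matrix_vector_mult_def flip: of_real_mult of_real_sum)
  moreover have "?x \<noteq> 0" using assms(2) by (simp add: vec_eq_iff)
  ultimately have "r \<in> {cmod l | l. \<exists>x. x \<noteq> 0 \<and> complex_mat M *v x = l *s x}"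
    using assms(3) by (intro CollectI exI[of _ "complex_of_real r"]) auto
  moreover have "finite {cmod l | l. \<exists>x. x \<noteq> 0 \<and> complex_mat M *v x = l *s x}"
    using finite_imageI[OF finite_eigenvalues[of "complex_mat M"], of cmod]
    by (simp add: image_Collect)
  ultimately show ?thesis unfolding spr_def by (rule Max_ge[rotated])
qed

text \<open>Serves to place (0, 0) in \<open>Gamma_set A\<close>. The constant vector supplies an
  eigenvalue, so the \<open>Max\<close> runs over a nonempty set, and the row sums bound every
  member.\<close>

lemma spr_stochastic_le_1:
  fixes M :: "'s::finite block"
  assumes "stochastic M"
  shows "spr M \<le> 1"
proof -
  let ?S = "{l. \<exists>x. x \<noteq> 0 \<and> complex_mat M *v x = l *s x}"
  have row: "(\<Sum>b\<in>UNIV. M $ a $ b) = 1" and nn: "0 \<le> M $ a $ b" for a b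
    using assms by (auto simp: stochastic_def nonneg_mat_def)
  have "complex_mat M *v 1 = 1 *s (1 :: complex ^ 's)"
    using row by (simp add: complex_mat_def vec_eq_iff matrix_vector_mult_def flip: of_real_sum)
  then have "1 \<in> ?S" by (intro CollectI exI[of _ 1]) (simp add: vec_eq_iff)
  moreover have "cmod l \<le> 1" if "l \<in> ?S" for l
  proof -
    from that obtain x where "complex_mat M *v x = l *s x" "x \<noteq> 0" by blast
    then obtain a where "cmod l \<le> (\<Sum>b\<in>UNIV. cmod (complex_mat M $ a $ b))"
      using eigenvalue_row_sum_bound by blast
    also have "\<dots> = 1" using row nn by (simp add: complex_mat_def)
    finally show ?thesis .
  qed
  ultimately have "Max (cmod ` ?S) \<le> 1"
    by (intro Max.boundedI) (use finite_eigenvalues[of "complex_mat M"] in blast)+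
  then show ?thesis by (simp add: spr_def image_Collect)
qed

text \<open>Normalizing \<open>I + M\<close> instead of \<open>M\<close> avoids dividing by zero when \<open>M x = 0\<close>.\<close>

lemma nonneg_eigenvector_exists:
  fixes M :: "'s::finite block"
  assumes "nonneg_mat M"
  shows "\<exists>x r. nonneg_vec x \<and> (\<Sum>a\<in>UNIV. x $ a) = 1 \<and> 0 \<le> r \<and> M *v x = r *s x"
proof -
  define S :: "(real ^ 's) set" where "S = {x. nonneg_vec x \<and> (\<Sum>a\<in>UNIV. x $ a) = 1}"
  define t where "t = (\<lambda>x. \<Sum>a\<in>UNIV. (x + M *v x) $ a)"
  define f where "f = (\<lambda>x. inverse (t x) *\<^sub>R (x + M *v x))"
  have nn: "0 \<le> (M *v x) $ a" if "nonneg_vec x" for x a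
    using assms that
    by (auto simp: matrix_vector_mult_def nonneg_mat_def nonneg_vec_def intro!: sum_nonneg)
  have t: "1 \<le> t x" if "x \<in> S" for x
    using that nn by (simp add: t_def S_def sum.distrib sum_nonneg)
  have "S \<subseteq> cball 0 1"
  proof
    fix x assume "x \<in> S"
    then have "norm x \<le> 1"
      using norm_le_l1_cart[of x] by (simp add: S_def nonneg_vec_def)
    then show "x \<in> cball 0 1" by simp
  qed
  moreover have "closed S"
  proof -
    have "S = (\<Inter>a. {x. 0 \<le> x $ a}) \<inter> {x. (\<Sum>a\<in>UNIV. x $ a) = 1}"
      by (auto simp: S_def nonneg_vec_def)
    then show ?thesis
      by (auto intro!: closed_INT closed_Int closed_Collect_le closed_Collect_eq continuous_intros)
  qed
  ultimately have "compact S"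
    by (meson bounded_cball bounded_subset compact_eq_bounded_closed)
  moreover have "convex S"
    by (auto simp: convex_def S_def nonneg_vec_def sum.distrib simp flip: sum_distrib_left)
  moreover have "S \<noteq> {}"
  proof -
    fix c :: 's
    have "axis c 1 \<in> S" by (auto simp: S_def nonneg_vec_def axis_def)
    then show ?thesis by auto
  qed
  moreover have "continuous_on S f"
  proof -
    have "continuous_on S (\<lambda>x. M *v x)"
      by (intro linear_continuous_on linear_conv_bounded_linear[THEN iffD1]
          matrix_vector_mul_linear)
    moreover have "\<forall>x\<in>S. t x \<noteq> 0" using t by fastforce
    ultimately show ?thesis unfolding f_def t_def by (intro continuous_intros) auto
  qed
  moreover have "f \<in> S \<rightarrow> S"
  proof
    fix x assume x: "x \<in> S"
    have "0 \<le> f x $ a" for a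
      using t[OF x] x nn[of x] unfolding f_def by (simp add: S_def nonneg_vec_def)
    moreover have "(\<Sum>a\<in>UNIV. f x $ a) = inverse (t x) * t x"
      unfolding f_def t_def sum_distrib_left by simp
    ultimately show "f x \<in> S" using t[OF x] by (simp add: S_def nonneg_vec_def)
  qed
  \<comment> \<open>At a fixed point \<open>x + M *v x\<close> equals \<open>t x\<close> times
    \<open>x\<close>, so the eigenvalue is \<open>t x - 1\<close>; it is nonnegative since
    \<open>t x\<close> is at least 1.\<close>
  ultimately obtain x where x: "x \<in> S" "f x = x" using brouwer by blast
  have "x + M *v x = t x *\<^sub>R f x" using t[OF x(1)] by (simp add: f_def)
  then have "M *v x = (t x - 1) *s x"
    using x(2) by (simp add: vec_eq_iff algebra_simps)
  with x(1) t[OF x(1)] show ?thesis unfolding S_def by (intro exI[of _ x] exI[of _ "t x - 1"]) auto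
qed

text \<open>Trades the spectral condition for an inequality that passes to limits and to geometric
  means, as the compactness and convexity arguments require.\<close>

lemma spr_le_1_imp_superharmonic:
  fixes M :: "'s::finite block"
  assumes "nonneg_mat M" "spr M \<le> 1"
  shows "\<exists>x. nonneg_vec x \<and> (\<Sum>a\<in>UNIV. x $ a) = 1 \<and> (\<forall>a. (M *v x) $ a \<le> x $ a)"
proof -
  obtain x r where x: "nonneg_vec x" "(\<Sum>a\<in>UNIV. x $ a) = 1" "0 \<le> r" "M *v x = r *s x"
    using nonneg_eigenvector_exists[OF assms(1)] by blast
  have "x \<noteq> 0" using x(2) by auto
  then have "r \<le> 1" using real_eigenvalue_le_spr[OF x(4) _ x(3)] assms(2) by simp
  then have "r * x $ a \<le> x $ a" for a
    using x(1) mult_right_mono[of r 1 "x $ a"] by (simp add: nonneg_vec_def)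
  with x show ?thesis by auto
qed


section \<open>Irreducibility as a reachability property\<close>

definition support_step :: "('x \<Rightarrow> 'x \<Rightarrow> real) \<Rightarrow> 'x set \<Rightarrow> 'x \<Rightarrow> 'x \<Rightarrow> bool" where
  "support_step P X x y \<longleftrightarrow> x \<in> X \<and> y \<in> X \<and> 0 < P x y"

definition connected_chain :: "('x \<Rightarrow> 'x \<Rightarrow> real) \<Rightarrow> 'x set \<Rightarrow> bool" where
  "connected_chain P X \<longleftrightarrow> (\<forall>x\<in>X. \<forall>y\<in>X. (support_step P X)\<^sup>*\<^sup>* x y)"

lemma irreducible_imp_connected:
  assumes nn: "\<And>x y. 0 \<le> P x y" and irr: "irreducible_chain P X"
  shows "connected_chain P X"
proof -
  have nstep_nn: "0 \<le> nstep P X n x y" for n x y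
    by (induction n arbitrary: x) (auto intro!: infsum_nonneg mult_nonneg_nonneg nn)
  have "(support_step P X)\<^sup>*\<^sup>* x y" if "0 < nstep P X n x y" "x \<in> X" "y \<in> X" for n x y
    using that
  proof (induction n arbitrary: x)
    case 0
    then show ?case by (simp split: if_splits)
  next
    case (Suc n)
    \<comment> \<open>If all terms vanished, the \<open>infsum\<close> would be 0. The default value
      0 for families that are not summable is excluded by positivity as well.\<close>
    have "\<exists>z\<in>X. P x z * nstep P X n z y \<noteq> 0"
    proof (rule ccontr)
      assume "\<not> ?thesis"
      then have "(\<Sum>\<^sub>\<infinity>z\<in>X. P x z * nstep P X n z y) = 0" by (intro infsum_0) auto
      with Suc.prems(1) show False by simp
    qed
    then obtain z where z: "z \<in> X" "P x z \<noteq> 0" "nstep P X n z y \<noteq> 0" by auto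
    then have "support_step P X x z"
      using nn[of x z] Suc.prems by (simp add: support_step_def)
    moreover have "(support_step P X)\<^sup>*\<^sup>* z y"
      using z nstep_nn[of n z y] Suc by (intro Suc.IH) auto
    ultimately show ?case by (rule converse_rtranclp_into_rtranclp)
  qed
  with irr show ?thesis unfolding irreducible_chain_def connected_chain_def by blast
qed

text \<open>Induction along a path. In this form irreducibility is exploited three times: for a
  uniform bound, for the loss by killing, and for the support of the invariant measure.\<close>

lemma connected_chain_invariant:
  assumes "connected_chain P X" "x \<in> X" "y \<in> X" "\<Phi> x"
    and "\<And>x y. \<Phi> x \<Longrightarrow> x \<in> X \<Longrightarrow> y \<in> X \<Longrightarrow> 0 < P x y \<Longrightarrow> \<Phi> y"
  shows "\<Phi> y"
proof -
  have "(support_step P X)\<^sup>*\<^sup>* x y" using assms(1-3) by (auto simp: connected_chain_def)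
  then show ?thesis using assms(4)
    by (induction rule: rtranclp_induct) (use assms(5) in \<open>auto simp: support_step_def\<close>)
qed

section \<open>Superharmonic vectors of the tilted matrices\<close>

definition tilted :: "(int \<Rightarrow> int \<Rightarrow> 's::finite block) \<Rightarrow> real \<Rightarrow> real \<Rightarrow> 's block" where
  "tilted A s t = (\<Sum>i\<in>HH. \<Sum>j\<in>HH. exp (of_int i * s + of_int j * t) *\<^sub>R A i j)"

text \<open>The vector is kept as part of the point, so that closedness can be read off from
  inequalities in \<open>(s, t, h)\<close>. The normalization keeps \<open>h\<close> in the compact
  simplex.\<close>

definition superharmonic_triple ::
  "(int \<Rightarrow> int \<Rightarrow> 's::finite block) \<Rightarrow> (real \<times> real \<times> (real ^ 's)) set" where
  "superharmonic_triple A = {(s, t, h). nonneg_vec h \<and> (\<Sum>a\<in>UNIV. h $ a) = 1 \<and>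
     (\<forall>a. (tilted A s t *v h) $ a \<le> h $ a)}"

lemma finite_HH [simp]: "finite HH"
  by (simp add: HH_def)

lemma tilted_nth:
  "tilted A s t $ a $ b = (\<Sum>i\<in>HH. \<Sum>j\<in>HH. exp (of_int i * s + of_int j * t) * A i j $ a $ b)"
  by (simp add: tilted_def)

lemma tilted_mult_nth:
  "(tilted A s t *v h) $ a =
     (\<Sum>b\<in>UNIV. \<Sum>i\<in>HH. \<Sum>j\<in>HH. exp (of_int i * s + of_int j * t) * A i j $ a $ b * h $ b)"
  by (simp add: matrix_vector_mult_def tilted_nth sum_distrib_right)

text \<open>A Harnack inequality: \<open>c\<close> is the product of the entries of \<open>A\<close>
  along a path from \<open>(0, 0, a)\<close> to \<open>(k, l, b)\<close>. The path is chosen before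
  \<open>s\<close>, \<open>t\<close> and \<open>h\<close>, so \<open>c\<close> is uniform in
  them.\<close>

lemma superharmonic_path_bound:
  fixes A :: "int \<Rightarrow> int \<Rightarrow> 's::finite block"
  assumes nn: "\<And>i j. i \<in> HH \<Longrightarrow> j \<in> HH \<Longrightarrow> nonneg_mat (A i j)"
    and conn: "connected_chain (plane_kernel A) UNIV"
  shows "\<exists>c>0. \<forall>s t h. (s, t, h) \<in> superharmonic_triple A \<longrightarrow>
           c * exp (of_int k * s + of_int l * t) * h $ b \<le> h $ a"
proof -
  define \<Phi> where "\<Phi> = (\<lambda>(k, l, b). \<exists>c>0. \<forall>s t h. (s, t, h) \<in> superharmonic_triple A \<longrightarrow>
           c * exp (of_int k * s + of_int l * t) * h $ b \<le> h $ a)"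
  have "\<Phi> (k, l, b)"
  proof (rule connected_chain_invariant[OF conn, of "(0, 0, a)"])
    show "\<Phi> (0, 0, a)" by (auto simp: \<Phi>_def intro!: exI[of _ 1])
  next
    fix x y :: "int \<times> int \<times> 's"
    assume "\<Phi> x" and step: "0 < plane_kernel A x y"
    obtain k l b where x: "x = (k, l, b)" by (cases x) auto
    obtain k' l' b' where y: "y = (k', l', b')" by (cases y) auto
    from step have ij: "k' - k \<in> HH" "l' - l \<in> HH" and p: "0 < A (k' - k) (l' - l) $ b $ b'"
      by (auto simp: x y split: if_splits)
    define p where "p = A (k' - k) (l' - l) $ b $ b'"
    obtain c where c: "0 < c" and
      bound: "\<And>s t h. (s, t, h) \<in> superharmonic_triple A \<Longrightarrow>
           c * exp (of_int k * s + of_int l * t) * h $ b \<le> h $ a"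
      using \<open>\<Phi> x\<close> unfolding x \<Phi>_def by auto
    have "c * p * exp (of_int k' * s + of_int l' * t) * h $ b' \<le> h $ a"
      if sth: "(s, t, h) \<in> superharmonic_triple A" for s t h
    proof -
      let ?f = "\<lambda>b' i j. exp (of_int i * s + of_int j * t) * A i j $ b $ b' * h $ b'"
      have hnn: "0 \<le> h $ d" for d using sth by (auto simp: superharmonic_triple_def nonneg_vec_def)
      have f: "0 \<le> ?f d i j" if "i \<in> HH" "j \<in> HH" for d i j
        using nn[OF that] hnn by (simp add: nonneg_mat_def)
      \<comment> \<open>Superharmonicity at \<open>b\<close> bounds a sum of nonnegative terms,
        hence also the single term that belongs to the transition just made.\<close>
      have "?f b' (k' - k) (l' - l) \<le> (\<Sum>j\<in>HH. ?f b' (k' - k) j)"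
        using ij f by (intro member_le_sum[where f="\<lambda>j. ?f b' (k' - k) j"]) (auto simp del: of_int_diff)
      also have "\<dots> \<le> (\<Sum>i\<in>HH. \<Sum>j\<in>HH. ?f b' i j)"
        using ij f by (intro member_le_sum[where f="\<lambda>i. \<Sum>j\<in>HH. ?f b' i j"] sum_nonneg) auto
      also have "\<dots> \<le> (\<Sum>d\<in>UNIV. \<Sum>i\<in>HH. \<Sum>j\<in>HH. ?f d i j)"
        using f by (intro member_le_sum[where f="\<lambda>d. \<Sum>i\<in>HH. \<Sum>j\<in>HH. ?f d i j"] sum_nonneg) auto
      also have "\<dots> \<le> h $ b"
        using sth by (auto simp: superharmonic_triple_def tilted_mult_nth)
      finally have "c * exp (of_int k * s + of_int l * t) * ?f b' (k' - k) (l' - l) \<le>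
          c * exp (of_int k * s + of_int l * t) * h $ b"
        using c by (intro mult_left_mono) auto
      also have "\<dots> \<le> h $ a" by (rule bound[OF sth])
      also have "c * exp (of_int k * s + of_int l * t) * ?f b' (k' - k) (l' - l) =
        c * p * (exp (of_int k * s + of_int l * t) *
          exp (of_int (k' - k) * s + of_int (l' - l) * t)) * h $ b'"
        by (simp add: p_def)
      also have "exp (of_int k * s + of_int l * t) *
          exp (of_int (k' - k) * s + of_int (l' - l) * t) = exp (of_int k' * s + of_int l' * t)"
        by (simp add: exp_add[symmetric] algebra_simps)
      finally show ?thesis .
    qed
    then show "\<Phi> y" using c p unfolding y \<Phi>_def p_def
      by (intro case_prodI exI[of _ "c * p"]) (auto simp: p_def)
  qed auto
  then show ?thesis by (simp add: \<Phi>_def)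
qed

text \<open>Some coordinate is positive since the sum is 1; a path with displacement 0 carries this
  to every other phase.\<close>

lemma superharmonic_triple_pos:
  fixes A :: "int \<Rightarrow> int \<Rightarrow> 's::finite block"
  assumes nn: "\<And>i j. i \<in> HH \<Longrightarrow> j \<in> HH \<Longrightarrow> nonneg_mat (A i j)"
    and conn: "connected_chain (plane_kernel A) UNIV"
    and sth: "(s, t, h) \<in> superharmonic_triple A"
  shows "0 < h $ a"
proof -
  have h: "\<And>b. 0 \<le> h $ b" "(\<Sum>b\<in>UNIV. h $ b) = 1"
    using sth by (auto simp: superharmonic_triple_def nonneg_vec_def)
  obtain b where "h $ b \<noteq> 0" using h(2) by (metis sum.neutral zero_neq_one)
  with h(1)[of b] have "0 < h $ b" by simp
  moreover obtain c where "0 < c" "c * exp (of_int 0 * s + of_int 0 * t) * h $ b \<le> h $ a"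
    using superharmonic_path_bound[OF nn conn, of 0 0 b a] sth by auto
  ultimately show ?thesis by (smt (verit, best) exp_gt_zero mult_pos_pos)
qed

text \<open>A path from \<open>(0, 0, a)\<close> back to the same phase at \<open>(k, l, a)\<close>
  gives, after cancelling \<open>h $ a\<close>, an upper bound on \<open>k s + l t\<close> that is
  uniform over all triples.\<close>

lemma compact_superharmonic_triple:
  fixes A :: "int \<Rightarrow> int \<Rightarrow> 's::finite block"
  assumes nn: "\<And>i j. i \<in> HH \<Longrightarrow> j \<in> HH \<Longrightarrow> nonneg_mat (A i j)"
    and conn: "connected_chain (plane_kernel A) UNIV"
  shows "compact (superharmonic_triple A)"
proof -
  fix a :: 's
  have upper: "\<exists>B. \<forall>(s, t, h)\<in>superharmonic_triple A. of_int k * s + of_int l * t \<le> B" for k l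
  proof -
    obtain c where c: "0 < c" and bound: "\<And>s t h. (s, t, h) \<in> superharmonic_triple A \<Longrightarrow>
           c * exp (of_int k * s + of_int l * t) * h $ a \<le> h $ a"
      using superharmonic_path_bound[OF nn conn, of k l a a] by auto
    have "of_int k * s + of_int l * t \<le> ln (1 / c)" if "(s, t, h) \<in> superharmonic_triple A" for s t h
    proof -
      have "c * exp (of_int k * s + of_int l * t) \<le> 1"
        using bound[OF that] superharmonic_triple_pos[OF nn conn that, of a] by simp
      then have "exp (of_int k * s + of_int l * t) \<le> 1 / c" using c by (simp add: field_simps)
      then show ?thesis using c by (subst ln_ge_iff) auto
    qed
    then show ?thesis by auto
  qed
  \<comment> \<open>The four unit displacements bound \<open>s\<close> and \<open>t\<close> from
    both sides.\<close>
  obtain B1 B2 B3 B4 where B: "\<And>s t h. (s, t, h) \<in> superharmonic_triple A \<Longrightarrow>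
      s \<le> B1 \<and> - s \<le> B2 \<and> t \<le> B3 \<and> - t \<le> B4"
    using upper[of 1 0] upper[of "-1" 0] upper[of 0 1] upper[of 0 "-1"] by fastforce
  have "superharmonic_triple A \<subseteq> {- B2..B1} \<times> {- B4..B3} \<times> cball 0 1"
  proof
    fix p assume "p \<in> superharmonic_triple A"
    then obtain s t h where p: "p = (s, t, h)" and sth: "(s, t, h) \<in> superharmonic_triple A"
      by (cases p) auto
    have "norm h \<le> 1"
      using sth norm_le_l1_cart[of h] by (simp add: superharmonic_triple_def nonneg_vec_def)
    with B[OF sth] show "p \<in> {- B2..B1} \<times> {- B4..B3} \<times> cball 0 1"
      unfolding p by auto
  qed
  then have "bounded (superharmonic_triple A)"
    by (rule bounded_subset[rotated]) (intro bounded_Times bounded_closed_interval bounded_cball)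
  moreover have "closed (superharmonic_triple A)"
  proof -
    have "superharmonic_triple A = (\<Inter>a. {p. 0 \<le> snd (snd p) $ a}) \<inter>
        {p. (\<Sum>a\<in>UNIV. snd (snd p) $ a) = 1} \<inter>
        (\<Inter>a. {p. (\<Sum>b\<in>UNIV. \<Sum>i\<in>HH. \<Sum>j\<in>HH. exp (of_int i * fst p + of_int j * fst (snd p)) *
            A i j $ a $ b * snd (snd p) $ b) \<le> snd (snd p) $ a})"
      by (auto simp: superharmonic_triple_def nonneg_vec_def tilted_mult_nth)
    then show ?thesis
      by (auto intro!: closed_INT closed_Int closed_Collect_le closed_Collect_eq continuous_intros)
  qed
  ultimately show ?thesis by (simp add: compact_eq_bounded_closed)
qed

text \<open>The weighted AM-GM inequality for the numbers \<open>exp x\<close> and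
  \<open>exp y\<close>.\<close>

lemma weighted_geometric_mean_le:
  fixes x y \<theta> \<eta> :: real
  assumes "0 \<le> \<theta>" "0 \<le> \<eta>" "\<theta> + \<eta> = 1"
  shows "exp (\<theta> * x + \<eta> * y) \<le> \<theta> * exp x + \<eta> * exp y"
proof -
  have \<theta>: "\<theta> = 1 - \<eta>" using assms(3) by simp
  show ?thesis using convex_onD[OF exp_convex, of \<eta> x y] assms(1,2) unfolding \<theta> by simp
qed

text \<open>
  Kingman's convexity: weighted geometric means of superharmonic vectors are superharmonic
  for the corresponding convex combination of the tilting parameters.
\<close>

lemma convex_fst_superharmonic_triple:
  fixes A :: "int \<Rightarrow> int \<Rightarrow> 's::finite block"
  assumes nn: "\<And>i j. i \<in> HH \<Longrightarrow> j \<in> HH \<Longrightarrow> nonneg_mat (A i j)"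
    and conn: "connected_chain (plane_kernel A) UNIV"
  shows "convex (fst ` superharmonic_triple A)"
proof (rule convexI)
  fix s s' \<theta> \<eta> :: real
  assume "s \<in> fst ` superharmonic_triple A" "s' \<in> fst ` superharmonic_triple A"
    and \<theta>: "0 \<le> \<theta>" "0 \<le> \<eta>" "\<theta> + \<eta> = 1"
  then obtain t h t' h' where sth: "(s, t, h) \<in> superharmonic_triple A"
    and sth': "(s', t', h') \<in> superharmonic_triple A" by auto
  have h: "0 < h $ a" and h': "0 < h' $ a" for a
    using superharmonic_triple_pos[OF nn conn] sth sth' by auto
  define S T where "S = \<theta> * s + \<eta> * s'" and "T = \<theta> * t + \<eta> * t'"
  define g where "g = (\<lambda>a. exp (\<theta> * ln (h $ a) + \<eta> * ln (h' $ a)))"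
  have g: "0 < g a" for a by (simp add: g_def)
  have le: "(\<Sum>b\<in>UNIV. \<Sum>i\<in>HH. \<Sum>j\<in>HH.
      exp (of_int i * S + of_int j * T) * A i j $ a $ b * g b) \<le> g a" for a
  proof -
    let ?f = "\<lambda>s t h b i j. exp (of_int i * s + of_int j * t) * A i j $ a $ b * h b"
    have "(\<Sum>b\<in>UNIV. \<Sum>i\<in>HH. \<Sum>j\<in>HH. ?f S T g b i j) / g a =
      (\<Sum>b\<in>UNIV. \<Sum>i\<in>HH. \<Sum>j\<in>HH. ?f S T g b i j / g a)"
      by (simp add: sum_divide_distrib)
    also have "\<dots> \<le> (\<Sum>b\<in>UNIV. \<Sum>i\<in>HH. \<Sum>j\<in>HH.
        \<theta> * (?f s t (($) h) b i j / h $ a) + \<eta> * (?f s' t' (($) h') b i j / h' $ a))"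
    proof (intro sum_mono)
      fix b i j assume "i \<in> HH" "j \<in> HH"
      then have p: "0 \<le> A i j $ a $ b" using nn by (simp add: nonneg_mat_def)
      let ?x = "of_int i * s + of_int j * t + ln (h $ b) - ln (h $ a)"
      let ?y = "of_int i * s' + of_int j * t' + ln (h' $ b) - ln (h' $ a)"
      have ratio: "exp u * h $ b / h $ a = exp (u + ln (h $ b) - ln (h $ a))"
          "exp u * h' $ b / h' $ a = exp (u + ln (h' $ b) - ln (h' $ a))" for u
        using h[of a] h[of b] h'[of a] h'[of b] by (auto simp: exp_add exp_diff)
      \<comment> \<open>Relative to \<open>g a\<close>, each term is the entry of \<open>A\<close>
        times the weighted geometric mean of the factors \<open>exp ?x\<close> and
        \<open>exp ?y\<close> belonging to \<open>h\<close> and \<open>h'\<close>.\<close>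
      have "?f S T g b i j / g a = A i j $ a $ b * exp (\<theta> * ?x + \<eta> * ?y)"
        by (simp add: g_def S_def T_def exp_add[symmetric] exp_diff[symmetric] algebra_simps
            flip: times_divide_eq_right)
      also have "\<dots> \<le> A i j $ a $ b * (\<theta> * exp ?x + \<eta> * exp ?y)"
        using p weighted_geometric_mean_le[OF \<theta>] by (rule mult_left_mono[rotated])
      also have "\<dots> = \<theta> * (?f s t (($) h) b i j / h $ a) + \<eta> * (?f s' t' (($) h') b i j / h' $ a)"
        unfolding ratio[symmetric] by (simp add: algebra_simps)
      finally show "?f S T g b i j / g a \<le> \<dots>" .
    qed
    also have "\<dots> = \<theta> * ((\<Sum>b\<in>UNIV. \<Sum>i\<in>HH. \<Sum>j\<in>HH. ?f s t (($) h) b i j) / h $ a) +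
        \<eta> * ((\<Sum>b\<in>UNIV. \<Sum>i\<in>HH. \<Sum>j\<in>HH. ?f s' t' (($) h') b i j) / h' $ a)"
      by (simp add: sum.distrib sum_distrib_left sum_divide_distrib)
    also have "\<dots> \<le> \<theta> * 1 + \<eta> * 1"
      using sth sth' h[of a] h'[of a] \<theta>
      by (intro add_mono mult_left_mono) (auto simp: superharmonic_triple_def tilted_mult_nth)
    finally show ?thesis using \<theta> g[of a] by (simp add: divide_le_eq)
  qed
  define G where "G = (\<Sum>a\<in>UNIV. g a)"
  have G: "0 < G" unfolding G_def using g by (intro sum_pos) auto
  have "(S, T, \<chi> a. g a / G) \<in> superharmonic_triple A"
  proof -
    have "(\<Sum>b\<in>UNIV. \<Sum>i\<in>HH. \<Sum>j\<in>HH.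
        exp (of_int i * S + of_int j * T) * A i j $ a $ b * (g b / G)) \<le> g a / G" for a
      using le[of a] G by (simp add: divide_right_mono flip: sum_divide_distrib)
    moreover have "(\<Sum>a\<in>UNIV. g a / G) = 1"
      using G by (simp add: G_def flip: sum_divide_distrib)
    ultimately show ?thesis using g G
      by (auto simp: superharmonic_triple_def nonneg_vec_def tilted_mult_nth less_imp_le)
  qed
  then show "\<theta> *\<^sub>R s + \<eta> *\<^sub>R s' \<in> fst ` superharmonic_triple A"
    by (force simp: S_def)
qed

text \<open>The admissible \<open>s\<close> form a compact interval containing the projection of
  \<open>Gamma_set A\<close>, hence also everything between the infimum and the supremum of that
  projection.\<close>

lemma superharmonic_triple_exists:
  fixes A :: "int \<Rightarrow> int \<Rightarrow> 's::finite block"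
  assumes nn: "\<And>i j. i \<in> HH \<Longrightarrow> j \<in> HH \<Longrightarrow> nonneg_mat (A i j)"
    and conn: "connected_chain (plane_kernel A) UNIV"
    and stoch: "stochastic (\<Sum>i\<in>HH. \<Sum>j\<in>HH. A i j)"
    and z: "z \<in> {z_lower1 A..z_upper1 A}"
  shows "\<exists>t h. (ln z, t, h) \<in> superharmonic_triple A"
proof -
  let ?I = "fst ` superharmonic_triple A" and ?J = "fst ` Gamma_set A"
  have "compact ?I"
    by (intro compact_continuous_image compact_superharmonic_triple[OF nn conn] continuous_intros)
  then have I: "closed ?I" "bdd_below ?I" "bdd_above ?I"
    by (auto intro: compact_imp_closed bounded_imp_bdd_below bounded_imp_bdd_above
        compact_imp_bounded)
  have sub: "?J \<subseteq> ?I"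
  proof clarify
    fix s t assume "(s, t) \<in> Gamma_set A"
    then have "spr (tilted A s t) \<le> 1" by (simp add: Gamma_set_def tilted_def)
    moreover have "nonneg_mat (tilted A s t)"
      using nn by (auto simp: nonneg_mat_def tilted_nth intro!: sum_nonneg)
    ultimately obtain h where "(s, t, h) \<in> superharmonic_triple A"
      using spr_le_1_imp_superharmonic by (fastforce simp: superharmonic_triple_def)
    then show "fst (s, t) \<in> ?I" by force
  qed
  \<comment> \<open>Nonemptiness makes the \<open>Inf\<close> and \<open>Sup\<close> in the interval
    bounds genuine.\<close>
  have "(0, 0) \<in> Gamma_set A"
    using spr_stochastic_le_1[OF stoch] by (simp add: Gamma_set_def)
  then have ne: "?J \<noteq> {}" by auto
  then have ne': "?I \<noteq> {}" using sub by blast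
  have "0 < z" using z by (auto simp: z_lower1_def intro: less_le_trans[OF exp_gt_zero])
  then have "Inf ?J \<le> ln z" "ln z \<le> Sup ?J"
    using z ln_le_cancel_iff[of z "exp (Sup ?J)"]
    by (simp_all add: z_lower1_def z_upper1_def ln_ge_iff)
  then have "Inf ?I \<le> ln z" "ln z \<le> Sup ?I"
    using cInf_superset_mono[OF ne I(2) sub] cSup_subset_mono[OF ne I(3) sub] by auto
  moreover have "Inf ?I \<in> ?I" "Sup ?I \<in> ?I"
    using closed_contains_Inf[OF ne' I(2,1)] closed_contains_Sup[OF ne' I(3,1)] by auto
  moreover have "is_interval ?I"
    using convex_fst_superharmonic_triple[OF nn conn] by (simp add: is_interval_convex_1)
  ultimately have "ln z \<in> ?I" unfolding is_interval_1 by blast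
  then show ?thesis by (metis imageE prod.collapse)
qed


section \<open>Convergence of the series \<open>N\<close>\<close>

text \<open>For \<open>n >= 1\<close> the \<open>n\<close>-th iterate sums the weighted values of
  \<open>f\<close> at the endpoints of \<open>n\<close>-step paths whose positions before the last
  step are nonnegative. The endpoint is unrestricted, so values of \<open>f\<close> at level -1
  count.\<close>

definition killed :: "(int \<Rightarrow> 's::finite block) \<Rightarrow> (int \<Rightarrow> 's \<Rightarrow> real) \<Rightarrow> int \<Rightarrow> 's \<Rightarrow> real" where
  "killed a f l x =
     (if l < 0 then 0 else \<Sum>i\<in>HH. \<Sum>y\<in>UNIV. a i $ x $ y * f (l + i) y)"

lemma killed_mono:
  assumes "\<And>i. i \<in> HH \<Longrightarrow> nonneg_mat (a i)" "\<And>l x. f l x \<le> g l x"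
  shows "killed a f l x \<le> killed a g l x"
  using assms by (auto simp: killed_def nonneg_mat_def intro!: sum_mono mult_left_mono)

lemma killed_pow_mono:
  assumes "\<And>i. i \<in> HH \<Longrightarrow> nonneg_mat (a i)" "\<And>l x. f l x \<le> g l x"
  shows "(killed a ^^ n) f l x \<le> (killed a ^^ n) g l x"
  by (induction n arbitrary: l x) (auto intro: killed_mono assms)

lemma killed_pow_nonneg:
  assumes "\<And>i. i \<in> HH \<Longrightarrow> nonneg_mat (a i)" "\<And>l x. 0 \<le> f l x"
  shows "0 \<le> (killed a ^^ n) f l x"
proof (induction n arbitrary: l x)
  case (Suc n)
  then show ?case using assms(1) by (auto simp: killed_def nonneg_mat_def intro!: sum_nonneg)
qed (simp add: assms)

lemma killed_pow_diff:
  "(killed a ^^ n) (\<lambda>l x. f l x - g l x) = (\<lambda>l x. (killed a ^^ n) f l x - (killed a ^^ n) g l x)"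
  by (induction n) (auto simp: killed_def fun_eq_iff right_diff_distrib sum_subtractf)

lemma killed_pow_scale:
  "(killed a ^^ n) (\<lambda>l x. c * f l x) = (\<lambda>l x. c * (killed a ^^ n) f l x)"
  by (induction n) (auto simp: killed_def fun_eq_iff sum_distrib_left mult_ac)

text \<open>Cutting \<open>H\<close> to zero at negative levels only decreases the one-step sums, so
  the inequality survives; monotonicity of \<open>killed a\<close> iterates it.\<close>

lemma killed_pow_superharmonic_le:
  fixes a :: "int \<Rightarrow> 's::finite block" and H :: "int \<Rightarrow> 's \<Rightarrow> real"
  assumes nn: "\<And>i. i \<in> HH \<Longrightarrow> nonneg_mat (a i)"
    and pos: "\<And>l x. 0 < H l x"
    and super: "\<And>l x. (\<Sum>i\<in>HH. \<Sum>y\<in>UNIV. a i $ x $ y * H (l + i) y) \<le> H l x"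
  defines "H0 \<equiv> \<lambda>l x. if l < 0 then 0 else H l x"
  shows "(killed a ^^ k) H0 l x \<le> H0 l x"
proof (induction k arbitrary: l x)
  case (Suc k)
  have "(killed a ^^ Suc k) H0 l x \<le> killed a H0 l x"
    by (simp, intro killed_mono nn Suc.IH)
  also have "\<dots> \<le> H0 l x"
  proof (cases "l < 0")
    case False
    have "killed a H0 l x \<le> killed a H l x"
      using pos by (intro killed_mono nn) (auto simp: H0_def less_imp_le)
    also have "\<dots> \<le> H0 l x" using False super by (simp add: killed_def H0_def)
    finally show ?thesis .
  qed (simp add: killed_def H0_def)
  finally show ?case .
qed simp

section \<open>Walk weights as iterates of the killed operator\<close>

text \<open>A free starting level allows recursion on the first step. The constraint includes
  \<open>k = 0\<close>, which is trivial for start 0, so that \<open>walks\<close> is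
  recovered.\<close>

definition walks_from :: "nat \<Rightarrow> int \<Rightarrow> int list set" where
  "walks_from n l = {is. length is = n \<and> set is \<subseteq> HH \<and>
     (\<forall>k<n. 0 \<le> l + sum_list (take k is)) \<and> l + sum_list is = 0}"

lemma walks_eq_walks_from: "walks n = walks_from n 0"
proof -
  have "(\<forall>k. 1 \<le> k \<and> k < n \<longrightarrow> 0 \<le> sum_list (take k is)) \<longleftrightarrow>
      (\<forall>k<n. 0 \<le> sum_list (take k is))" for "is" :: "int list"
    by (metis One_nat_def Suc_leI gr0I order_refl sum_list.Nil take0)
  then show ?thesis by (simp add: walks_def walks_from_def)
qed

lemma finite_walks_from: "finite (walks_from n l)"
  by (rule finite_subset[OF _ finite_lists_length_eq[OF finite_HH, of n]])
    (auto simp: walks_from_def)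

lemma walks_from_0: "walks_from 0 l = (if l = 0 then {[]} else {})"
  by (auto simp: walks_from_def)

lemma walks_from_Suc:
  "walks_from (Suc n) l = (if l < 0 then {} else (\<Union>i\<in>HH. (#) i ` walks_from n (l + i)))"
proof -
  have mem: "is \<in> walks_from (Suc n) l \<longleftrightarrow>
      0 \<le> l \<and> is \<in> (\<Union>i\<in>HH. (#) i ` walks_from n (l + i))" for "is"
  proof (cases "is")
    case (Cons i js)
    have "(\<forall>k<Suc n. 0 \<le> l + sum_list (take k (i # js))) \<longleftrightarrow>
        0 \<le> l \<and> (\<forall>k<n. 0 \<le> l + i + sum_list (take k js))"
      by (simp add: All_less_Suc2 add.assoc)
    then have "is \<in> walks_from (Suc n) l \<longleftrightarrow> 0 \<le> l \<and> i \<in> HH \<and> js \<in> walks_from n (l + i)"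
      by (auto simp: walks_from_def Cons add.assoc)
    then show ?thesis by (auto simp: Cons)
  qed (auto simp: walks_from_def)
  show ?thesis
  proof (cases "l < 0")
    case True
    then have "walks_from (Suc n) l = {}" using mem by auto
    with True show ?thesis by simp
  next
    case False
    then show ?thesis by (intro set_eqI) (simp only: mem, simp)
  qed
qed

lemma walk_weight_Nil [simp]: "walk_weight a [] = mat 1"
  and walk_weight_Cons [simp]: "walk_weight a (i # is) = a i ** walk_weight a is"
  by (simp_all add: walk_weight_def)

lemma walk_weight_append: "walk_weight a (is @ js) = walk_weight a is ** walk_weight a js"
  by (induction "is") (simp_all add: matrix_mul_assoc)

text \<open>Both sides obey the same first-step recursion. The entries of \<open>N_mat\<close> are
  thereby values of the Green function of the killed walk.\<close>

lemma sum_walk_weight_eq_killed: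
  "(\<Sum>is\<in>walks_from n l. walk_weight a is) $ x $ b =
     (killed a ^^ n) (\<lambda>l y. if l = 0 \<and> y = b then 1 else 0) l x"
proof (induction n arbitrary: l x)
  case 0
  then show ?case by (simp add: walks_from_0 mat_def)
next
  case (Suc n)
  let ?\<delta> = "\<lambda>l y. if l = 0 \<and> y = b then 1 else 0 :: real"
  show ?case
  proof (cases "l < 0")
    case False
    have "(\<Sum>is\<in>walks_from (Suc n) l. walk_weight a is) =
        (\<Sum>i\<in>HH. \<Sum>is\<in>(#) i ` walks_from n (l + i). walk_weight a is)"
      using False by (simp add: walks_from_Suc)
        (subst sum.UNION_disjoint, auto simp: finite_walks_from)
    also have "\<dots> = (\<Sum>i\<in>HH. \<Sum>is\<in>walks_from n (l + i). a i ** walk_weight a is)"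
      by (simp add: sum.reindex inj_on_def)
    also have "\<dots> $ x $ b = (\<Sum>i\<in>HH. \<Sum>is\<in>walks_from n (l + i).
        \<Sum>y\<in>UNIV. a i $ x $ y * walk_weight a is $ y $ b)"
      by (simp add: matrix_matrix_mult_def)
    also have "\<dots> = (\<Sum>i\<in>HH. \<Sum>y\<in>UNIV. a i $ x $ y *
        (\<Sum>is\<in>walks_from n (l + i). walk_weight a is) $ y $ b)"
      by (simp add: sum_distrib_left sum.swap[of _ UNIV])
    also have "\<dots> = (killed a ^^ Suc n) ?\<delta> l x"
      using False by (simp only: Suc.IH) (simp add: killed_def[of a "(killed a ^^ n) ?\<delta>"])
    finally show ?thesis .
  qed (simp add: walks_from_Suc killed_def)
qed

lemma nonneg_walk_weight:
  assumes "\<And>i. i \<in> HH \<Longrightarrow> nonneg_mat (a i)" "set is \<subseteq> HH"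
  shows "nonneg_mat (walk_weight a is)"
  using assms(2)
proof (induction "is")
  case Nil
  then show ?case by (simp add: nonneg_mat_def mat_def)
next
  case (Cons i "is")
  then show ?case using assms(1)[of i]
    by (auto simp: nonneg_mat_def matrix_matrix_mult_def intro!: sum_nonneg)
qed

section \<open>Finiteness of the Green function\<close>

text \<open>The blocks will be generating functions, so row sums may differ from 1. The kernel
  enters through the positivity of its transitions.\<close>

definition level_kernel :: "(int \<Rightarrow> 's::finite block) \<Rightarrow> int \<times> 's \<Rightarrow> int \<times> 's \<Rightarrow> real" where
  "level_kernel a = (\<lambda>(l, x) (m, y). if m - l \<in> HH then a (m - l) $ x $ y else 0)"

text \<open>
  The function \<open>H\<close>, killed below level 0, is superharmonic for the killed walk. If its iterates
  under \<open>killed a\<close> never dropped at \<open>(0, b)\<close>, this equality would propagate along all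
  transitions, and so no negative level could be reached from \<open>(0, b)\<close>.
\<close>

lemma killed_pow_eventually_less:
  fixes a :: "int \<Rightarrow> 's::finite block" and H :: "int \<Rightarrow> 's \<Rightarrow> real"
  assumes nn: "\<And>i. i \<in> HH \<Longrightarrow> nonneg_mat (a i)"
    and conn: "connected_chain (level_kernel a) UNIV"
    and pos: "\<And>l x. 0 < H l x"
    and super: "\<And>l x. (\<Sum>i\<in>HH. \<Sum>y\<in>UNIV. a i $ x $ y * H (l + i) y) \<le> H l x"
  defines "H0 \<equiv> \<lambda>l x. if l < 0 then 0 else H l x"
  shows "\<exists>k. (killed a ^^ k) H0 0 b < H0 0 b"
proof (rule ccontr)
  assume none: "\<not> ?thesis"
  have H0_le: "H0 l x \<le> H l x" for l x using pos[of l x] by (simp add: H0_def)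
  have le: "(killed a ^^ k) H0 l x \<le> H0 l x" for k l x
    unfolding H0_def using nn pos super by (rule killed_pow_superharmonic_le)
  define \<Phi> where "\<Phi> = (\<lambda>(l, x). 0 \<le> l \<and> (\<forall>k. (killed a ^^ k) H0 l x = H l x))"
  have "\<Phi> (-1, b)"
  proof (rule connected_chain_invariant[OF conn, of "(0, b)"])
    have "(killed a ^^ k) H0 0 b = H0 0 b" for k
      using none le[of k 0 b] by (metis not_less order.antisym)
    then show "\<Phi> (0, b)" by (simp add: \<Phi>_def H0_def)
  next
    fix p q :: "int \<times> 's"
    assume p: "\<Phi> p" and pq: "0 < level_kernel a p q"
    obtain l x where lx: "p = (l, x)" by (cases p) auto
    obtain m y where my: "q = (m, y)" by (cases q) auto
    have l: "0 \<le> l" "\<And>k. (killed a ^^ k) H0 l x = H l x" using p by (auto simp: lx \<Phi>_def)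
    have i: "m - l \<in> HH" "0 < a (m - l) $ x $ y"
      using pq by (auto simp: lx my level_kernel_def split: if_splits)
    have eq: "(killed a ^^ k) H0 m y = H m y" for k
    proof (rule ccontr)
      assume "(killed a ^^ k) H0 m y \<noteq> H m y"
      with le[of k m y] H0_le[of m y] have less: "(killed a ^^ k) H0 m y < H m y" by linarith
      have term_le: "a i $ x $ y * (killed a ^^ k) H0 (l + i) y \<le> a i $ x $ y * H (l + i) y"
        if "i \<in> HH" for i y
        using nn[OF that] le[of k "l + i" y] H0_le[of "l + i" y]
        by (auto simp: nonneg_mat_def intro!: mult_left_mono)
      \<comment> \<open>A strict loss at the successor after \<open>k\<close> iterations would
        appear as a strict loss at \<open>(l, x)\<close> after \<open>k + 1\<close>
        iterations.\<close>
      have "(killed a ^^ Suc k) H0 l x =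
          (\<Sum>i\<in>HH. \<Sum>y\<in>UNIV. a i $ x $ y * (killed a ^^ k) H0 (l + i) y)"
        using l(1) by (simp add: killed_def)
      also have "\<dots> < (\<Sum>i\<in>HH. \<Sum>y\<in>UNIV. a i $ x $ y * H (l + i) y)"
      proof (intro sum_strict_mono_ex1 ballI sum_mono term_le)
        show "\<exists>i\<in>HH. (\<Sum>y\<in>UNIV. a i $ x $ y * (killed a ^^ k) H0 (l + i) y) <
            (\<Sum>y\<in>UNIV. a i $ x $ y * H (l + i) y)"
        proof (rule bexI[OF _ i(1)])
          show "(\<Sum>y\<in>UNIV. a (m - l) $ x $ y * (killed a ^^ k) H0 (l + (m - l)) y) <
            (\<Sum>y\<in>UNIV. a (m - l) $ x $ y * H (l + (m - l)) y)"
            using i less term_le[OF i(1)]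
            by (intro sum_strict_mono_ex1) (auto intro!: exI[of _ y])
        qed
      qed auto
      also have "\<dots> \<le> H l x" by (rule super)
      finally show False using l(2)[of "Suc k"] by simp
    qed
    \<comment> \<open>For \<open>k = 0\<close> the equality says that \<open>H0 m y\<close> equals
      the positive number \<open>H m y\<close>, which excludes negative levels.\<close>
    moreover have "0 \<le> m" using eq[of 0] pos[of m y] by (simp add: H0_def split: if_splits)
    ultimately show "\<Phi> q" by (simp add: my \<Phi>_def)
  qed auto
  then show False by (simp add: \<Phi>_def)
qed

text \<open>The loss of \<open>H0\<close> after \<open>k\<close> killed steps is nonnegative
  everywhere and equals \<open>\<epsilon>\<close> at \<open>(0, b)\<close>, so it dominates
  \<open>\<epsilon>\<close> times the indicator \<open>\<delta>\<close>. Applying the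
  \<open>n\<close>-th iterate bounds the \<open>n\<close>-th term by \<open>d n - d (n + k)\<close>,
  up to the factor \<open>\<epsilon>\<close>, and these differences telescope.\<close>

lemma summable_walk_weights:
  fixes a :: "int \<Rightarrow> 's::finite block" and H :: "int \<Rightarrow> 's \<Rightarrow> real"
  assumes nn: "\<And>i. i \<in> HH \<Longrightarrow> nonneg_mat (a i)"
    and conn: "connected_chain (level_kernel a) UNIV"
    and pos: "\<And>l x. 0 < H l x"
    and super: "\<And>l x. (\<Sum>i\<in>HH. \<Sum>y\<in>UNIV. a i $ x $ y * H (l + i) y) \<le> H l x"
  shows "summable (\<lambda>n. (\<Sum>is\<in>walks n. walk_weight a is) $ x $ b)"
proof -
  define H0 where "H0 = (\<lambda>l x. if l < 0 then 0 else H l x)"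
  define \<delta> :: "int \<Rightarrow> 's \<Rightarrow> real" where "\<delta> = (\<lambda>l y. if l = 0 \<and> y = b then 1 else 0)"
  obtain k where k: "(killed a ^^ k) H0 0 b < H0 0 b"
    using killed_pow_eventually_less[OF nn conn pos super] unfolding H0_def by blast
  define d where "d = (\<lambda>n. (killed a ^^ n) H0 0 x)"
  have d_nn: "0 \<le> d n" for n
    unfolding d_def using pos by (intro killed_pow_nonneg nn) (auto simp: H0_def less_imp_le)
  have le: "(killed a ^^ k) H0 l x \<le> H0 l x" for k l x
    unfolding H0_def using nn pos super by (rule killed_pow_superharmonic_le)
  define \<epsilon> where "\<epsilon> = H0 0 b - (killed a ^^ k) H0 0 b"
  have \<epsilon>: "0 < \<epsilon>" using k by (simp add: \<epsilon>_def)
  have drop: "\<epsilon> * (killed a ^^ n) \<delta> 0 x \<le> d n - d (n + k)" for n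
  proof -
    have "\<epsilon> * (killed a ^^ n) \<delta> 0 x = (killed a ^^ n) (\<lambda>l x. \<epsilon> * \<delta> l x) 0 x"
      by (simp add: killed_pow_scale)
    also have "\<dots> \<le> (killed a ^^ n) (\<lambda>l x. H0 l x - (killed a ^^ k) H0 l x) 0 x"
      using le by (intro killed_pow_mono nn) (auto simp: \<delta>_def \<epsilon>_def)
    also have "\<dots> = d n - d (n + k)" by (simp add: killed_pow_diff d_def funpow_add)
    finally show ?thesis .
  qed
  have telescope: "(\<Sum>m<n. d m - d (m + k)) = (\<Sum>m<k. d m) - (\<Sum>m<k. d (n + m))" for n
  proof (induction n)
    case (Suc n)
    have "d n + (\<Sum>m<k. d (Suc n + m)) = (\<Sum>m<k. d (n + m)) + d (n + k)"
      using sum.lessThan_Suc_shift[of "\<lambda>m. d (n + m)" k] by simp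
    with Suc show ?case by simp
  qed simp
  have "(\<Sum>m<n. (killed a ^^ m) \<delta> 0 x) \<le> (\<Sum>m<k. d m) / \<epsilon>" for n
  proof -
    have "\<epsilon> * (\<Sum>m<n. (killed a ^^ m) \<delta> 0 x) \<le> (\<Sum>m<n. d m - d (m + k))"
      unfolding sum_distrib_left by (intro sum_mono drop)
    also have "\<dots> \<le> (\<Sum>m<k. d m)" unfolding telescope using d_nn by (simp add: sum_nonneg)
    finally show ?thesis using \<epsilon> by (simp add: field_simps)
  qed
  moreover have "0 \<le> (killed a ^^ m) \<delta> 0 x" for m
    by (intro killed_pow_nonneg nn) (auto simp: \<delta>_def)
  ultimately have "summable (\<lambda>n. (killed a ^^ n) \<delta> 0 x)"
    by (intro summableI_nonneg_bounded)
  then show ?thesis by (simp only: walks_eq_walks_from sum_walk_weight_eq_killed \<delta>_def)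
qed

lemma summable_vec:
  fixes f :: "nat \<Rightarrow> 'a::real_normed_vector ^ 'n::finite"
  assumes "\<And>i. summable (\<lambda>n. f n $ i)"
  shows "summable f" "suminf f $ i = (\<Sum>n. f n $ i)"
proof -
  have "f sums (\<chi> i. \<Sum>n. f n $ i)"
    unfolding sums_def
    by (rule vec_tendstoI) (simp add: assms summable_LIMSEQ)
  then show "summable f" "suminf f $ i = (\<Sum>n. f n $ i)"
    by (auto simp: sums_iff)
qed


section \<open>Positivity of invariant measures\<close>

text \<open>\<open>N_mat\<close> is a \<open>suminf\<close>. Convergence is assumed here so that its
  entries can be read term by term; \<open>summable_walk_weights\<close> supplies it later.\<close>

locale level_process =
  fixes a :: "int \<Rightarrow> 's::finite block"
  assumes nonneg: "i \<in> HH \<Longrightarrow> nonneg_mat (a i)"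
    and summable: "summable (\<lambda>n. (\<Sum>is\<in>walks n. walk_weight a is) $ x $ b)"
begin

lemma walk_weight_nonneg: "is \<in> walks n \<Longrightarrow> 0 \<le> walk_weight a is $ x $ b"
  using nonneg_walk_weight[of a "is"] nonneg by (auto simp: walks_def nonneg_mat_def)

lemma N_mat_nth: "N_mat a $ x $ b = (\<Sum>n. (\<Sum>is\<in>walks n. walk_weight a is) $ x $ b)"
  unfolding N_mat_def
  by (subst summable_vec, intro summable_vec summable, subst summable_vec, rule summable, rule refl)

lemma nonneg_N_mat: "nonneg_mat (N_mat a)"
  unfolding nonneg_mat_def N_mat_nth
  by (intro allI suminf_nonneg summable) (auto intro!: sum_nonneg walk_weight_nonneg)

text \<open>Nothing cancels in a series of nonnegative terms. Positivity of an entry becomes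
  existence of a walk, so supports can be handled by concatenating walks.\<close>

lemma N_mat_pos_iff:
  "0 < N_mat a $ x $ b \<longleftrightarrow> (\<exists>n. \<exists>is\<in>walks n. 0 < walk_weight a is $ x $ b)"
proof -
  have "finite (walks n)" for n by (simp add: walks_eq_walks_from finite_walks_from)
  then have "0 < (\<Sum>is\<in>walks n. walk_weight a is) $ x $ b \<longleftrightarrow>
      (\<exists>is\<in>walks n. 0 < walk_weight a is $ x $ b)" for n
    using walk_weight_nonneg[of _ n x b]
    by (simp add: less_le sum_nonneg sum_nonneg_eq_0_iff)
  then show ?thesis unfolding N_mat_nth
    by (subst suminf_pos_iff[OF summable]) (auto intro!: sum_nonneg walk_weight_nonneg)
qed

lemma N_mat_diag_pos: "0 < N_mat a $ x $ x"
  unfolding N_mat_pos_iff by (intro exI[of _ 0] bexI[of _ "[]"]) (auto simp: walks_def mat_def)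

end

lemma mult_pos_entry:
  fixes M N :: "'s::finite block"
  assumes "nonneg_mat M" "nonneg_mat N" "0 < M $ x $ y" "0 < N $ y $ z"
  shows "0 < (M ** N) $ x $ z"
proof -
  have "0 < M $ x $ y * N $ y $ z" using assms by simp
  also have "\<dots> \<le> (\<Sum>y\<in>UNIV. M $ x $ y * N $ y $ z)"
    using assms(1,2) by (intro member_le_sum) (auto simp: nonneg_mat_def)
  finally show ?thesis by (simp add: matrix_matrix_mult_def)
qed

lemma nonneg_mat_mult:
  fixes M N :: "'s::finite block"
  shows "nonneg_mat M \<Longrightarrow> nonneg_mat N \<Longrightarrow> nonneg_mat (M ** N)"
  by (auto simp: nonneg_mat_def matrix_matrix_mult_def intro!: sum_nonneg)

lemma nonneg_vec_mult:
  fixes M :: "'s::finite block"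
  shows "nonneg_vec p \<Longrightarrow> nonneg_mat M \<Longrightarrow> nonneg_vec (p v* M)"
  by (auto simp: nonneg_mat_def nonneg_vec_def vector_matrix_mult_def intro!: sum_nonneg)

lemma vec_mult_pos_iff:
  fixes M :: "'s::finite block"
  assumes "nonneg_vec p" "nonneg_mat M"
  shows "0 < (p v* M) $ b \<longleftrightarrow> (\<exists>c. 0 < p $ c \<and> 0 < M $ c $ b)"
proof -
  have nn: "0 \<le> p $ c" "0 \<le> M $ c $ b" for c
    using assms by (auto simp: nonneg_vec_def nonneg_mat_def)
  have "0 < (\<Sum>c\<in>UNIV. M $ c $ b * p $ c) \<longleftrightarrow> (\<exists>c. M $ c $ b * p $ c \<noteq> 0)"
    using nn by (simp add: less_le sum_nonneg sum_nonneg_eq_0_iff)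
  also have "\<dots> \<longleftrightarrow> (\<exists>c. 0 < p $ c \<and> 0 < M $ c $ b)"
    using nn by (simp add: less_le) blast
  finally show ?thesis by (simp add: vector_matrix_mult_def mult.commute)
qed

lemma vector_matrix_mul_add_rdistrib: "x v* (M + N) = x v* M + x v* (N :: 's::finite block)"
  by (simp add: vector_matrix_mult_def vec_eq_iff distrib_left sum.distrib)

lemma mat_power_Suc_right: "mat_power M (Suc k) = mat_power M k ** M"
  by (induction k) (simp_all add: matrix_mul_assoc)

section \<open>Concatenation of walks\<close>

context level_process
begin

lemma walks_snoc_0: "is \<in> walks n \<Longrightarrow> is @ [0] \<in> walks (Suc n)"
  by (auto simp: walks_def HH_def take_Cons' less_Suc_eq_le le_less)

text \<open>Between the up step and the down step the partial sums are those of \<open>q\<close>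
  raised by 1.\<close>

lemma walks_excursion:
  assumes p: "p \<in> walks m" and q: "q \<in> walks n"
  shows "p @ 1 # q @ [-1] \<in> walks (m + n + 2)"
proof -
  \<comment> \<open>\<open>walks\<close> constrains only prefixes with \<open>1 <= k < l\<close>;
    the remaining prefixes have sum 0.\<close>
  have partial: "0 \<le> sum_list (take k r)" if "r \<in> walks l" for k l r
    using that by (cases "k = 0 \<or> l \<le> k") (auto simp: walks_def)
  have "0 \<le> sum_list (take k (p @ 1 # q @ [-1]))" if k: "k < m + n + 2" for k
  proof (cases "k \<le> m")
    case True
    then show ?thesis using partial[OF p] p by (simp add: walks_def)
  next
    case False
    then obtain j where j: "k = m + Suc j" "j \<le> n"
      using k by (metis Suc_diff_Suc add.assoc add_2_eq_Suc' add_Suc_right add_less_cancel_left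
          less_Suc_eq_le less_imp_add_positive not_less gr0_implies_Suc)
    then show ?thesis using partial[OF q, of j] p q by (simp add: walks_def)
  qed
  then show ?thesis using p q by (auto simp: walks_def HH_def)
qed

lemma N_mat_pos_step_0:
  assumes "0 < N_mat a $ x $ y" "0 < a 0 $ y $ z"
  shows "0 < N_mat a $ x $ z"
proof -
  obtain n "is" where p: "is \<in> walks n" "0 < walk_weight a is $ x $ y"
    using assms(1) by (auto simp: N_mat_pos_iff)
  have "0 < walk_weight a (is @ [0]) $ x $ z"
    unfolding walk_weight_append using p assms(2) nonneg
    by (intro mult_pos_entry[of _ _ x y]) (auto simp: walks_def HH_def intro!: nonneg_walk_weight)
  then show ?thesis using walks_snoc_0[OF p(1)] by (auto simp: N_mat_pos_iff)
qed

text \<open>Together with \<open>N_mat_pos_step_0\<close> this gives, on supports, one direction of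
  \<open>N = I + N a_0 + N a_1 N a_(-1)\<close>: a walk may be extended by a level step or by an
  excursion above level 0.\<close>

lemma N_mat_pos_excursion:
  assumes "0 < N_mat a $ x $ y" "0 < a 1 $ y $ y'" "0 < N_mat a $ y' $ z'" "0 < a (-1) $ z' $ z"
  shows "0 < N_mat a $ x $ z"
proof -
  obtain m p where p: "p \<in> walks m" "0 < walk_weight a p $ x $ y"
    using assms(1) by (auto simp: N_mat_pos_iff)
  obtain n q where q: "q \<in> walks n" "0 < walk_weight a q $ y' $ z'"
    using assms(3) by (auto simp: N_mat_pos_iff)
  have nn: "nonneg_mat (walk_weight a p)" "nonneg_mat (walk_weight a q)"
      "nonneg_mat (a 1)" "nonneg_mat (a (-1))"
    using p q nonneg by (auto simp: walks_def HH_def intro!: nonneg_walk_weight)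
  have "0 < walk_weight a (p @ 1 # q @ [-1]) $ x $ z"
    using p q assms nn
    by (simp add: walk_weight_append)
      (intro mult_pos_entry[of _ _ x y] mult_pos_entry[of _ _ y y'] mult_pos_entry[of _ _ y' z']
        nonneg_mat_mult)
  then show ?thesis using walks_excursion[OF p(1) q(1)] by (auto simp: N_mat_pos_iff)
qed

end

section \<open>Support of the invariant measure\<close>

definition reflected_kernel ::
  "(int \<Rightarrow> 's::finite block) \<Rightarrow> (int \<Rightarrow> 's block) \<Rightarrow> int \<times> 's \<Rightarrow> int \<times> 's \<Rightarrow> real" where
  "reflected_kernel a b = (\<lambda>(l, x) (m, y).
     if l \<noteq> 0 then level_kernel a (l, x) (m, y)
     else if m \<in> HHp then b m $ x $ y else 0)"

text \<open>Level 0 carries \<open>u\<close> and level \<open>k + 1\<close> carries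
  \<open>X k\<close>. The support is shown to be closed under each kind of transition, and
  irreducibility spreads it from one positive entry of \<open>u\<close>.\<close>

lemma (in level_process) invariant_measure_pos:
  assumes b: "\<And>j. j \<in> HHp \<Longrightarrow> nonneg_mat (b j)"
    and conn: "connected_chain (reflected_kernel a b) {(l, x). 0 \<le> l}"
    and u: "nonneg_vec u" "u \<noteq> 0" "u v* (b 0 + b 1 ** G_mat a) = u"
  shows "pos_vec u" "pos_vec (u v* (b 1 ** N_mat a ** mat_power (R_mat a) k))"
proof -
  define X where "X = (\<lambda>k. u v* (b 1 ** N_mat a ** mat_power (R_mat a) k))"
  \<comment> \<open>\<open>q k\<close> is the mass entering level \<open>k + 1\<close> from level
    \<open>k\<close>. Multiplication by \<open>N_mat a\<close> adds all paths that stay at or above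
    level \<open>k + 1\<close> and end there.\<close>
  define q where "q = (\<lambda>k. case k of 0 \<Rightarrow> u v* b 1 | Suc k \<Rightarrow> X k v* a 1)"
  have nn: "nonneg_mat (b 0)" "nonneg_mat (b 1)" "nonneg_mat (a 0)" "nonneg_mat (a 1)"
      "nonneg_mat (a (-1))"
    using b nonneg by (auto simp: HH_def HHp_def)
  have X0: "X 0 = u v* b 1 v* N_mat a"
    by (simp add: X_def vector_matrix_mul_assoc)
  have XS: "X (Suc k) = X k v* a 1 v* N_mat a" for k
    unfolding X_def mat_power_Suc_right R_mat_def
    by (simp add: vector_matrix_mul_assoc matrix_mul_assoc)
  have Xq: "X k = q k v* N_mat a" for k by (cases k) (simp_all add: q_def X0 XS)
  have X_nn: "nonneg_vec (X k)" for k
    by (induction k) (simp_all add: X0 XS nonneg_vec_mult u nn nonneg_N_mat)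
  have q_nn: "nonneg_vec (q k)" for k by (cases k) (simp_all add: q_def nonneg_vec_mult u nn X_nn)
  have X_pos: "0 < X k $ y \<longleftrightarrow> (\<exists>c. 0 < q k $ c \<and> 0 < N_mat a $ c $ y)" for k y
    unfolding Xq by (rule vec_mult_pos_iff[OF q_nn nonneg_N_mat])
  have q_imp_X: "0 < X k $ y" if "0 < q k $ y" for k y
    using that N_mat_diag_pos[of y] by (auto simp: X_pos)
  \<comment> \<open>Since \<open>G_mat a\<close> ends with a down step, the eigenvector equation is
    the balance equation at level 0.\<close>
  have u_eq: "u = u v* b 0 + X 0 v* a (-1)"
    by (subst u(3)[symmetric], simp add: X0 G_mat_def vector_matrix_mul_add_rdistrib
        vector_matrix_mul_assoc matrix_mul_assoc)
  have u_pos: "0 < u $ y" if "0 < (u v* b 0) $ y \<or> 0 < (X 0 v* a (-1)) $ y" for y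
  proof -
    have "0 \<le> (u v* b 0) $ y" "0 \<le> (X 0 v* a (-1)) $ y"
      using nonneg_vec_mult[OF u(1) nn(1)] nonneg_vec_mult[OF X_nn nn(5)]
      by (auto simp: nonneg_vec_def)
    then show ?thesis using that by (subst u_eq) auto
  qed
  define Y where "Y = (\<lambda>l. if l = 0 then u else X (nat (l - 1)))"
  obtain x0 where x0: "0 < u $ x0"
    using u(1,2) by (auto simp: nonneg_vec_def vec_eq_iff less_le)
  have Y_pos: "0 < Y l $ x" if l: "0 \<le> l" for l x
  proof -
    have "(\<lambda>(l, x). 0 < Y l $ x) (l, x)"
    proof (rule connected_chain_invariant[OF conn, of "(0, x0)"])
      show "case (0, x0) of (l, x) \<Rightarrow> 0 < Y l $ x" using x0 by (simp add: Y_def)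
    next
      fix s t :: "int \<times> 's"
      assume s: "case s of (l, x) \<Rightarrow> 0 < Y l $ x" and dom: "s \<in> {(l, x). 0 \<le> l}" "t \<in> {(l, x). 0 \<le> l}"
        and step: "0 < reflected_kernel a b s t"
      obtain l x where lx: "s = (l, x)" by (cases s) auto
      obtain m y where my: "t = (m, y)" by (cases t) auto
      have pos: "0 < Y l $ x" and lm: "0 \<le> l" "0 \<le> m" using s dom by (auto simp: lx my)
      have "0 < Y m $ y"
      proof (cases "l = 0")
        case True
        then have "m = 0 \<and> 0 < b 0 $ x $ y \<or> m = 1 \<and> 0 < b 1 $ x $ y"
          using step by (auto simp: lx my reflected_kernel_def HHp_def split: if_splits)
        moreover have "0 < u $ x" using pos True by (simp add: Y_def)
        moreover from this have "0 < (u v* b j) $ y" if "0 < b j $ x $ y" "j \<in> HHp" for j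
          using that vec_mult_pos_iff[OF u(1) b] by blast
        ultimately show ?thesis
          using u_pos[of y] q_imp_X[of 0 y] by (auto simp: Y_def q_def HHp_def)
      next
        case False
        define k where "k = nat (l - 1)"
        have l_eq: "l = int k + 1" using False lm by (simp add: k_def)
        have Xk: "0 < X k $ x" using pos by (simp add: Y_def l_eq)
        then obtain c where c: "0 < q k $ c" "0 < N_mat a $ c $ x" by (auto simp: X_pos)
        have "m - l \<in> {-1, 0, 1}" and p: "0 < a (m - l) $ x $ y"
          using step False
          by (auto simp: lx my reflected_kernel_def level_kernel_def HH_def split: if_splits)
        then consider "m = l" | "m = l + 1" | "m = l - 1" by force
        then show ?thesis
        proof cases
          case 1
          then have "0 < N_mat a $ c $ y" using c p by (auto intro: N_mat_pos_step_0)
          then show ?thesis using c 1 by (auto simp: Y_def l_eq X_pos)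
        next
          case 2
          then have "0 < q (Suc k) $ y"
            using Xk p X_nn nn by (auto simp: q_def vec_mult_pos_iff)
          then show ?thesis using q_imp_X 2 by (simp add: Y_def l_eq nat_add_distrib)
        next
          case 3
          show ?thesis
          proof (cases k)
            case 0
            then have "0 < (X 0 v* a (-1)) $ y"
              using 3 Xk p X_nn nn by (auto simp: vec_mult_pos_iff)
            then show ?thesis using u_pos 3 by (simp add: Y_def l_eq 0)
          next
            \<comment> \<open>The mass at \<open>x\<close> stems from an up step from
              \<open>d\<close> to \<open>c\<close> followed by a walk from \<open>c\<close> to
              \<open>x\<close>. The down step to \<open>y\<close> closes this to an excursion above
              the level of \<open>d\<close>, which \<open>N_mat a\<close> at that level already
              counts.\<close>
            case (Suc j)
            then obtain d where d: "0 < X j $ d" "0 < a 1 $ d $ c"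
              using c(1) X_nn nn by (auto simp: q_def vec_mult_pos_iff)
            then obtain e where e: "0 < q j $ e" "0 < N_mat a $ e $ d" by (auto simp: X_pos)
            have "0 < N_mat a $ e $ y"
              using 3 e(2) d(2) c(2) p by (intro N_mat_pos_excursion[of e d c x y]) auto
            then show ?thesis using e 3 by (auto simp: Y_def l_eq Suc X_pos)
          qed
        qed
      qed
      then show "case t of (l, x) \<Rightarrow> 0 < Y l $ x" by (simp add: my)
    qed (use l in auto)
    then show ?thesis by simp
  qed
  show "pos_vec u" using Y_pos[of 0] by (simp add: Y_def pos_vec_def)
  show "pos_vec (u v* (b 1 ** N_mat a ** mat_power (R_mat a) k))"
    using Y_pos[of "int k + 1"] by (simp add: Y_def pos_vec_def X_def)
qed

section \<open>The two half planes\<close>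

text \<open>Paths are mapped step by step. This serves both for forgetting the first coordinate and
  for exchanging the two coordinates.\<close>

lemma connected_chain_map:
  assumes "connected_chain P X"
    and "f ` X = Y"
    and "\<And>x y. x \<in> X \<Longrightarrow> y \<in> X \<Longrightarrow> 0 < P x y \<Longrightarrow> 0 < Q (f x) (f y)"
  shows "connected_chain Q Y"
proof -
  have "(support_step Q Y)\<^sup>*\<^sup>* (f x) (f y)" if "(support_step P X)\<^sup>*\<^sup>* x y" for x y
    using that
  proof (induction rule: rtranclp_induct)
    case (step y z)
    then have "support_step Q Y (f y) (f z)"
      using assms(2,3) by (auto simp: support_step_def)
    with step.IH show ?case by (rule rtranclp.rtrancl_into_rtrancl)
  qed simp
  then show ?thesis using assms(1,2) by (auto simp: connected_chain_def)
qed

lemma gf1_nth: "gf1 B j z $ x $ y = (\<Sum>i\<in>HH. z powi i * B i j $ x $ y)"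
  by (simp add: gf1_def)

lemma nonneg_gf1:
  assumes "0 < z" "\<And>i. i \<in> HH \<Longrightarrow> nonneg_mat (B i j)"
  shows "nonneg_mat (gf1 B j z)"
  using assms by (auto simp: nonneg_mat_def gf1_nth intro!: sum_nonneg mult_nonneg_nonneg)

lemma gf1_pos:
  assumes "0 < z" "\<And>i. i \<in> HH \<Longrightarrow> nonneg_mat (B i j)" "i \<in> HH" "0 < B i j $ x $ y"
  shows "0 < gf1 B j z $ x $ y"
proof -
  have "0 < z powi i * B i j $ x $ y" using assms by simp
  also have "\<dots> \<le> (\<Sum>i\<in>HH. z powi i * B i j $ x $ y)"
    using assms by (intro member_le_sum) (auto simp: nonneg_mat_def)
  finally show ?thesis by (simp add: gf1_nth)
qed

text \<open>The first coordinate is absorbed into the weights \<open>z powi i\<close>. What remains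
  is a process on levels and phases, reflected at level 0 with the blocks of
  \<open>B\<close>.\<close>

lemma half_plane_positivity:
  fixes A B :: "int \<Rightarrow> int \<Rightarrow> 's::finite block"
  assumes A: "\<And>i j. i \<in> HH \<Longrightarrow> j \<in> HH \<Longrightarrow> nonneg_mat (A i j)"
    and B: "\<And>i j. i \<in> HH \<Longrightarrow> j \<in> HHp \<Longrightarrow> nonneg_mat (B i j)"
    and stoch: "stochastic (\<Sum>i\<in>HH. \<Sum>j\<in>HH. A i j)"
    and plane: "connected_chain (plane_kernel A) UNIV"
    and upper: "connected_chain (upper_kernel A B) upper_half"
    and z: "z \<in> {z_lower1 A..z_upper1 A}" "psi1 A B z = 1"
    and pf: "perron_frobenius_pair (C1 B z (G1 A z)) u v"
  shows "pos_vec u" "pos_vec (u v* (gf1 B 1 z ** N1 A z ** mat_power (R1 A z) k))"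
proof -
  let ?a = "\<lambda>j. gf1 A j z" and ?b = "\<lambda>j. gf1 B j z"
  have z_pos: "0 < z" using z by (auto simp: z_lower1_def intro: less_le_trans[OF exp_gt_zero])
  obtain t h where sth: "(ln z, t, h) \<in> superharmonic_triple A"
    using superharmonic_triple_exists[OF A plane stoch z(1)] by blast
  have h: "0 < h $ x" for x using superharmonic_triple_pos[OF A plane sth] .
  define H where "H = (\<lambda>l x. exp (of_int l * t) * h $ x)"
  have a_nn: "nonneg_mat (?a j)" if "j \<in> HH" for j using that z_pos A by (intro nonneg_gf1)
  have b_nn: "nonneg_mat (?b j)" if "j \<in> HHp" for j using that z_pos B by (intro nonneg_gf1)
  have super: "(\<Sum>j\<in>HH. \<Sum>y\<in>UNIV. ?a j $ x $ y * H (l + j) y) \<le> H l x" for l x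
  proof -
    \<comment> \<open>Identifies the blocks at \<open>z\<close> with the tilting by
      \<open>s = ln z\<close>; the factor \<open>exp (of_int l * t)\<close> then comes out of the
      sum by translation invariance.\<close>
    have "exp (of_int i * ln z) = z powi i" for i
      using z_pos powr_real_of_int'[of z i] by (simp add: powr_def)
    then have "?a j $ x $ y * H (l + j) y = exp (of_int l * t) *
        (\<Sum>i\<in>HH. exp (of_int i * ln z + of_int j * t) * A i j $ x $ y * h $ y)" for j y
      by (simp add: gf1_nth H_def sum_distrib_left sum_distrib_right exp_add ring_distribs mult_ac)
    then have "(\<Sum>j\<in>HH. \<Sum>y\<in>UNIV. ?a j $ x $ y * H (l + j) y) = exp (of_int l * t) *
        (\<Sum>j\<in>HH. \<Sum>y\<in>UNIV. \<Sum>i\<in>HH. exp (of_int i * ln z + of_int j * t) * A i j $ x $ y * h $ y)"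
      by (simp add: sum_distrib_left)
    also have "(\<Sum>j\<in>HH. \<Sum>y\<in>UNIV. \<Sum>i\<in>HH.
          exp (of_int i * ln z + of_int j * t) * A i j $ x $ y * h $ y) =
        (tilted A (ln z) t *v h) $ x"
      unfolding tilted_mult_nth by (subst sum.swap, rule sum.cong[OF refl], rule sum.swap)
    also have "\<dots> \<le> h $ x" using sth by (simp add: superharmonic_triple_def)
    finally show ?thesis by (simp add: H_def)
  qed
  \<comment> \<open>Every transition in the plane projects to a positive transition between levels,
    since the weights \<open>z powi i\<close> are positive.\<close>
  have level: "connected_chain (level_kernel ?a) UNIV"
  proof (rule connected_chain_map[OF plane, of snd])
    show "range snd = UNIV" by force
  next
    fix p q :: "int \<times> int \<times> 's" assume "0 < plane_kernel A p q"
    then show "0 < level_kernel ?a (snd p) (snd q)"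
      by (cases p; cases q) (auto simp: level_kernel_def z_pos A intro!: gf1_pos split: if_splits)
  qed
  have "0 < H l x" for l x using h by (simp add: H_def)
  from summable_walk_weights[OF a_nn level this super] a_nn interpret level_process ?a
    by unfold_locales
  have refl: "connected_chain (reflected_kernel ?a ?b) {(l, x). 0 \<le> l}"
  proof (rule connected_chain_map[OF upper, of snd])
    show "snd ` upper_half = {(l, x). 0 \<le> l}" by (force simp: upper_half_def)
  next
    fix p q :: "int \<times> int \<times> 's" assume "0 < upper_kernel A B p q"
    then show "0 < reflected_kernel ?a ?b (snd p) (snd q)"
      by (cases p; cases q) (auto simp: reflected_kernel_def level_kernel_def z_pos A B
          intro!: gf1_pos split: if_splits)
  qed
  \<comment> \<open>\<open>psi1 A B z = 1\<close> makes the eigenvalue 1, and the normalization of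
    the pair rules out \<open>u = 0\<close>.\<close>
  have u: "nonneg_vec u" "u \<noteq> 0" "u v* (?b 0 + ?b 1 ** G_mat ?a) = u"
    using pf z(2) by (auto simp: perron_frobenius_pair_def psi1_def C1_def G1_def)
  show "pos_vec u" "pos_vec (u v* (gf1 B 1 z ** N1 A z ** mat_power (R1 A z) k))"
    using invariant_measure_pos[of ?b u, OF b_nn refl u] by (auto simp: N1_def R1_def)
qed

lemma plane_kernel_nonneg:
  "(\<And>i j. i \<in> HH \<Longrightarrow> j \<in> HH \<Longrightarrow> nonneg_mat (A i j)) \<Longrightarrow> 0 \<le> plane_kernel A p q"
  by (cases p; cases q) (auto simp: nonneg_mat_def)

lemma upper_kernel_nonneg:
  "(\<And>i j. i \<in> HH \<Longrightarrow> j \<in> HH \<Longrightarrow> nonneg_mat (A i j)) \<Longrightarrow>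
   (\<And>i j. i \<in> HH \<Longrightarrow> j \<in> HHp \<Longrightarrow> nonneg_mat (B i j)) \<Longrightarrow> 0 \<le> upper_kernel A B p q"
  by (cases p; cases q) (auto simp: nonneg_mat_def)

lemma right_kernel_nonneg:
  "(\<And>i j. i \<in> HH \<Longrightarrow> j \<in> HH \<Longrightarrow> nonneg_mat (A i j)) \<Longrightarrow>
   (\<And>i j. i \<in> HHp \<Longrightarrow> j \<in> HH \<Longrightarrow> nonneg_mat (B i j)) \<Longrightarrow> 0 \<le> right_kernel A B p q"
  by (cases p; cases q) (auto simp: nonneg_mat_def)

section \<open>Exchange of the two coordinates\<close>

lemma Gamma_set_swap: "Gamma_set (\<lambda>i j. A j i) = prod.swap ` Gamma_set A"
proof -
  have "(\<Sum>i\<in>HH. \<Sum>j\<in>HH. exp (of_int i * s + of_int j * t) *\<^sub>R A j i) =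
      (\<Sum>i\<in>HH. \<Sum>j\<in>HH. exp (of_int i * t + of_int j * s) *\<^sub>R A i j)" for s t
    by (subst sum.swap) (simp add: add.commute)
  then show ?thesis by (force simp: Gamma_set_def image_iff)
qed

lemma gf1_swap: "gf1 (\<lambda>i j. B j i) = gf2 B"
  by (simp add: fun_eq_iff gf1_def gf2_def)

text \<open>Transposing the indices of both block families and swapping the coordinates of the
  states turns the right half plane into the upper one.\<close>

lemma half_plane_positivity_right:
  fixes A B :: "int \<Rightarrow> int \<Rightarrow> 's::finite block"
  assumes A: "\<And>i j. i \<in> HH \<Longrightarrow> j \<in> HH \<Longrightarrow> nonneg_mat (A i j)"
    and B: "\<And>i j. i \<in> HHp \<Longrightarrow> j \<in> HH \<Longrightarrow> nonneg_mat (B i j)"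
    and stoch: "stochastic (\<Sum>i\<in>HH. \<Sum>j\<in>HH. A i j)"
    and plane: "connected_chain (plane_kernel A) UNIV"
    and right: "connected_chain (right_kernel A B) right_half"
    and w: "w \<in> {z_lower2 A..z_upper2 A}" "psi2 A B w = 1"
    and pf: "perron_frobenius_pair (C2 B (G2 A w) w) u v"
  shows "pos_vec u" "pos_vec (u v* (gf2 B 1 w ** N2 A w ** mat_power (R2 A w) k))"
proof -
  let ?A = "\<lambda>i j. A j i" and ?B = "\<lambda>i j. B j i"
  let ?swap = "\<lambda>(x1, x2, c). (x2, x1, c) :: int \<times> int \<times> 's"
  have eqs: "z_lower1 ?A = z_lower2 A" "z_upper1 ?A = z_upper2 A"
      "N1 ?A = N2 A" "R1 ?A = R2 A" "G1 ?A = G2 A" "C1 ?B w X = C2 B X w" for X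
    by (simp_all add: z_lower1_def z_lower2_def z_upper1_def z_upper2_def Gamma_set_swap[of A]
        image_image N1_def N2_def R1_def R2_def G1_def G2_def C1_def C2_def gf1_swap[of A] gf1_swap[of B] fun_eq_iff)
  have "stochastic (\<Sum>i\<in>HH. \<Sum>j\<in>HH. ?A i j)" using stoch by (subst sum.swap)
  moreover have "connected_chain (plane_kernel ?A) UNIV"
  proof (rule connected_chain_map[OF plane, of ?swap])
    show "range ?swap = UNIV" by (rule surjI[of _ ?swap]) auto
  next
    fix p q :: "int \<times> int \<times> 's" assume "0 < plane_kernel A p q"
    then show "0 < plane_kernel ?A (?swap p) (?swap q)"
      by (cases p; cases q) (auto split: if_splits)
  qed
  moreover have "connected_chain (upper_kernel ?A ?B) upper_half"
  proof (rule connected_chain_map[OF right, of ?swap])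
    show "?swap ` right_half = upper_half" by (force simp: right_half_def upper_half_def)
  next
    fix p q :: "int \<times> int \<times> 's" assume "0 < right_kernel A B p q"
    then show "0 < upper_kernel ?A ?B (?swap p) (?swap q)"
      by (cases p; cases q) (auto split: if_splits)
  qed
  moreover have "psi1 ?A ?B w = 1" using w(2) by (simp add: psi1_def psi2_def eqs)
  ultimately show "pos_vec u" "pos_vec (u v* (gf2 B 1 w ** N2 A w ** mat_power (R2 A w) k))"
    using half_plane_positivity[of ?A ?B w u v] A B w(1) pf by (simp_all add: eqs gf1_swap[of B])
qed

theorem proposition5p10:
  fixes A A1 A2 :: "int \<Rightarrow> int \<Rightarrow> 's::finite block"
  assumes "\<And>i j. i \<in> HH \<Longrightarrow> j \<in> HH \<Longrightarrow> nonneg_mat (A i j)"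
    and "\<And>i j. i \<in> HH \<Longrightarrow> j \<in> HHp \<Longrightarrow> nonneg_mat (A1 i j)"
    and "\<And>i j. i \<in> HHp \<Longrightarrow> j \<in> HH \<Longrightarrow> nonneg_mat (A2 i j)"
    and "stochastic (\<Sum>i\<in>HH. \<Sum>j\<in>HH. A i j)"
    and "stochastic (\<Sum>i\<in>HH. \<Sum>j\<in>HHp. A1 i j)"
    and "stochastic (\<Sum>i\<in>HHp. \<Sum>j\<in>HH. A2 i j)"
    and "irreducible_chain (plane_kernel A) UNIV"
    and "aperiodic_chain (plane_kernel A) UNIV"
    and "irreducible_chain (upper_kernel A A1) upper_half"
    and "aperiodic_chain (upper_kernel A A1) upper_half"
    and "irreducible_chain (right_kernel A A2) right_half"
    and "aperiodic_chain (right_kernel A A2) right_half"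
  shows "(\<forall>z0 \<in> {z_lower1 A .. z_upper1 A}. psi1 A A1 z0 = 1 \<longrightarrow>
            (\<forall>u v. perron_frobenius_pair (C1 A1 z0 (G1 A z0)) u v \<longrightarrow>
               pos_vec u \<and>
               (\<forall>k::nat. pos_vec (u v* (gf1 A1 1 z0 ** N1 A z0 ** mat_power (R1 A z0) k)))))
       \<and> (\<forall>w0 \<in> {z_lower2 A .. z_upper2 A}. psi2 A A2 w0 = 1 \<longrightarrow>
            (\<forall>u v. perron_frobenius_pair (C2 A2 (G2 A w0) w0) u v \<longrightarrow>
               pos_vec u \<and>
               (\<forall>k::nat. pos_vec (u v* (gf2 A2 1 w0 ** N2 A w0 ** mat_power (R2 A w0) k)))))"
proof -
  have plane: "connected_chain (plane_kernel A) UNIV"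
    by (intro irreducible_imp_connected plane_kernel_nonneg assms(1,7))
  have upper: "connected_chain (upper_kernel A A1) upper_half"
    by (intro irreducible_imp_connected upper_kernel_nonneg assms(1,2,9))
  have right: "connected_chain (right_kernel A A2) right_half"
    by (intro irreducible_imp_connected right_kernel_nonneg assms(1,3,11))
  show ?thesis
    using half_plane_positivity[OF assms(1,2,4) plane upper]
      half_plane_positivity_right[OF assms(1,3,4) plane right]
    by blast
qed

end
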